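(* Let $G$ be an amenable topological group with small invariant neighborhoods (SIN) and let $\nu$ be a symmetric regular Borel probability measure on $G$ with countable support. Then, for any open identity neighborhood $U$ in $G$, $$\limsup_{n\to\infty}\nu^{n}(U^n)^{1/n}=1 .$$
   Context: All topological groups are assumed Hausdorff. $\mathcal U(G)$ denotes the neighborhood filter of the neutral element of $G$. $G$ has small invariant neighborhoods (SIN) if $\mathcal U(G)$ has a filter base consisting of conjugation-invariant sets. $G$ is amenable if the space $\mathrm{RUCB}(G)=\{f\in\ell^\infty(G)\mid \forall\epsilon>0\ \exists U\in\mathcal U(G)\ \forall x\in G\ \forall y\in Ux\colon |f(x)-f(y)|\le\epsilon\}$ of real-valued functions admits a left-invariant mean, i.e., a positive unital linear functional $m\colon\mathrm{RUCB}(G)\to\mathbb R$ with $m(f\circ\lambda_g)=m(f)$ for all $f$ and all $g\in G$, where $\lambda_g(x)=gx$. A measure $\nu$ is symmetric if $\nu(A)=\nu(A^{-1})$ for all Borel $A$. Countable support means that $\nu$ is concentrated on a countable set, i.e., it is a countable convex combination of point masses. $\nu^n$ denotes the $n$-fold convolution power of $\nu$, and $U^n=\{u_1\cdots u_n\mid u_1,\dots,u_n\in U\}$. *)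

theory Defs
  imports "HOL-Probability.Probability"
begin

text \<open>
  Topological groups are rendered by the library class \<open>topological_group_add\<close>. It does not
  assume commutativity: the group is merely written additively, so that \<open>x + y\<close>, \<open>- x\<close> and \<open>0\<close>
  stand for the product, the inverse and the neutral element. The Hausdorff assumption is the
  class \<open>t2_space\<close>.
\<close>

definition identity_nhds :: "'a::topological_group_add set set" where
  "identity_nhds = {U. eventually (\<lambda>x. x \<in> U) (nhds 0)}"

definition SIN_group :: "'a::topological_group_add itself \<Rightarrow> bool" where
  "SIN_group _ \<longleftrightarrow> (\<exists>\<B> \<subseteq> (identity_nhds :: 'a set set).
     (\<forall>U\<in>identity_nhds. \<exists>V\<in>\<B>. V \<subseteq> U) \<and> (\<forall>V\<in>\<B>. \<forall>g. (\<lambda>x. g + x - g) ` V = V))"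

definition RUCB :: "('a::topological_group_add \<Rightarrow> real) set" where
  "RUCB = {f. bounded (range f) \<and>
     (\<forall>\<epsilon>>0. \<exists>U\<in>identity_nhds. \<forall>x. \<forall>y\<in>(\<lambda>u. u + x) ` U. \<bar>f x - f y\<bar> \<le> \<epsilon>)}"

text \<open>Only the values of \<open>m\<close> on \<open>RUCB\<close> matter.\<close>

definition left_invariant_mean :: "(('a::topological_group_add \<Rightarrow> real) \<Rightarrow> real) \<Rightarrow> bool" where
  "left_invariant_mean m \<longleftrightarrow>
     (\<forall>f\<in>RUCB. \<forall>h\<in>RUCB. m (\<lambda>x. f x + h x) = m f + m h) \<and>
     (\<forall>c. \<forall>f\<in>RUCB. m (\<lambda>x. c * f x) = c * m f) \<and>
     (\<forall>f\<in>RUCB. (\<forall>x. 0 \<le> f x) \<longrightarrow> 0 \<le> m f) \<and>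
     m (\<lambda>_. 1) = 1 \<and>
     (\<forall>f\<in>RUCB. \<forall>g. m (f \<circ> (\<lambda>x. g + x)) = m f)"

definition amenable_group :: "'a::topological_group_add itself \<Rightarrow> bool" where
  "amenable_group _ \<longleftrightarrow> (\<exists>m :: ('a \<Rightarrow> real) \<Rightarrow> real. left_invariant_mean m)"

definition regular_measure :: "'a::topological_space measure \<Rightarrow> bool" where
  "regular_measure M \<longleftrightarrow> (\<forall>B\<in>sets borel.
     emeasure M B = (SUP K\<in>{K. compact K \<and> K \<in> sets borel \<and> K \<subseteq> B}. emeasure M K) \<and>
     emeasure M B = (INF V\<in>{V. open V \<and> B \<subseteq> V}. emeasure M V))"

definition symmetric_measure :: "'a::topological_group_add measure \<Rightarrow> bool" where
  "symmetric_measure M \<longleftrightarrow> (\<forall>A\<in>sets borel. emeasure M A = emeasure M (uminus ` A))"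

definition countably_supported :: "'a measure \<Rightarrow> bool" where
  "countably_supported M \<longleftrightarrow> (\<exists>C. countable C \<and> (AE x in M. x \<in> C))"

text \<open>
  The convolution is not defined as a push-forward of the product measure, since without second
  countability the group operation need not be measurable with respect to the product of the
  Borel \<open>\<sigma>\<close>-algebras. For countably supported factors the lemma \<open>emeasure_group_convolution\<close>
  below shows that the set function in the definition is indeed a measure.
\<close>

definition group_convolution ::
    "'a::topological_group_add measure \<Rightarrow> 'a measure \<Rightarrow> 'a measure" where
  "group_convolution M N =
     measure_of UNIV (sets borel) (\<lambda>A. \<integral>\<^sup>+x. emeasure N {y. x + y \<in> A} \<partial>M)"

primrec conv_power :: "'a::topological_group_add measure \<Rightarrow> nat \<Rightarrow> 'a measure" where
  "conv_power M 0 = return borel 0"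
| "conv_power M (Suc n) = group_convolution M (conv_power M n)"

definition set_power :: "'a::monoid_add set \<Rightarrow> nat \<Rightarrow> 'a set" where
  "set_power U n = {sum_list us | us. length us = n \<and> set us \<subseteq> U}"

lemma sets_group_convolution [simp]: "sets (group_convolution M N) = sets borel"
  unfolding group_convolution_def by (metis sets.sigma_sets_eq sets_measure_of space_borel subset_UNIV
    Pow_UNIV)

lemma translate_measurable [measurable]:
  "(\<lambda>y. x + y) \<in> borel_measurable (borel :: 'a::topological_group_add measure)"
  "(\<lambda>y. y + x) \<in> borel_measurable (borel :: 'a::topological_group_add measure)"
  by (intro borel_measurable_continuous_onI continuous_on_add continuous_on_const continuous_on_id)+

lemma translate_sets:
  fixes A :: "'a::topological_group_add set"
  assumes "A \<in> sets borel"
  shows "{y. x + y \<in> A} \<in> sets borel" "{y. y + x \<in> A} \<in> sets borel"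
  using measurable_sets[OF translate_measurable(1)[of x] assms]
    measurable_sets[OF translate_measurable(2)[of x] assms]
  by (simp_all add: vimage_def)

lemma emeasure_countably_supported:
  fixes N :: "'a::t2_space measure"
  assumes N: "sets N = sets borel" and C: "countable C" "AE x in N. x \<in> C"
    and B: "B \<in> sets borel"
  shows "emeasure N B = (\<integral>\<^sup>+y. emeasure N {y} * indicator B y \<partial>count_space C)"
proof -
  have sing: "{y} \<in> sets N" for y using N by simp
  have cB: "C \<inter> B \<in> sets N"
    using C(1) by (intro sets.countable[OF sing]) (auto intro: countable_subset)
  have "emeasure N B = emeasure N (C \<inter> B)"
    using C(2) B cB N by (intro emeasure_eq_AE) auto
  also have "\<dots> = (\<integral>\<^sup>+y. emeasure N {y} \<partial>count_space (C \<inter> B))"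
    using C(1) cB sing by (intro emeasure_countable_singleton) (auto intro: countable_subset)
  also have "\<dots> = (\<integral>\<^sup>+y. emeasure N {y} * indicator B y \<partial>count_space C)"
    by (subst (1 2) nn_integral_count_space_indicator)
      (auto intro!: nn_integral_cong split: split_indicator)
  finally show ?thesis .
qed

lemma measurable_translate_emeasure:
  fixes N :: "'a::{topological_group_add,t2_space} measure"
  assumes N: "sets N = sets borel" "countably_supported N" and A: "A \<in> sets borel"
  shows "(\<lambda>x. emeasure N {y. x + y \<in> A}) \<in> borel_measurable borel"
proof -
  obtain C where C: "countable C" "AE x in N. x \<in> C"
    using N(2) by (auto simp: countably_supported_def)
  have "(\<lambda>x. \<integral>\<^sup>+y. emeasure N {y} * indicator {x. x + y \<in> A} x \<partial>count_space C)
      \<in> borel_measurable borel"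
  proof (rule sigma_finite_measure.borel_measurable_nn_integral
      [OF sigma_finite_measure_count_space_countable[OF C(1)]])
    have "(\<lambda>x. emeasure N {y} * indicator {x. x + y \<in> A} x) \<in> borel_measurable borel" for y
      using translate_sets(2)[OF A, of y] by simp
    then have "(\<lambda>p. emeasure N {snd p} * indicator {x. x + snd p \<in> A} (fst p))
        \<in> borel_measurable (borel \<Otimes>\<^sub>M count_space C)"
      by (intro measurable_compose_countable'[where g = snd and I = C and
          f = "\<lambda>y p. emeasure N {y} * indicator {x. x + y \<in> A} (fst p)", OF _ _ C(1)]
          measurable_compose[OF measurable_fst] measurable_snd)
    then show "(\<lambda>(x, y). emeasure N {y} * indicator {x. x + y \<in> A} x)
        \<in> borel_measurable (borel \<Otimes>\<^sub>M count_space C)"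
      by (simp add: case_prod_beta')
  qed
  also have "(\<lambda>x. \<integral>\<^sup>+y. emeasure N {y} * indicator {x. x + y \<in> A} x \<partial>count_space C)
      = (\<lambda>x. emeasure N {y. x + y \<in> A})"
    by (intro ext, subst emeasure_countably_supported[OF N(1) C translate_sets(1)[OF A]])
      (auto intro!: nn_integral_cong split: split_indicator)
  finally show ?thesis .
qed

lemma emeasure_group_convolution:
  fixes M N :: "'a::{topological_group_add,t2_space} measure"
  assumes M: "sets M = sets borel" and N: "sets N = sets borel" "countably_supported N"
    and A: "A \<in> sets borel"
  shows "emeasure (group_convolution M N) A = (\<integral>\<^sup>+x. emeasure N {y. x + y \<in> A} \<partial>M)"
proof (rule emeasure_measure_of[OF group_convolution_def])
  show "sets borel \<subseteq> Pow (UNIV :: 'a set)" by simp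
  show "A \<in> sets (group_convolution M N)" using A by simp
  show "positive (sets (group_convolution M N)) (\<lambda>A. \<integral>\<^sup>+x. emeasure N {y. x + y \<in> A} \<partial>M)"
    by (simp add: positive_def)
  show "countably_additive (sets (group_convolution M N))
      (\<lambda>A. \<integral>\<^sup>+x. emeasure N {y. x + y \<in> A} \<partial>M)"
  proof (rule countably_additiveI)
    fix F :: "nat \<Rightarrow> 'a set"
    assume F: "range F \<subseteq> sets (group_convolution M N)" "disjoint_family F"
    then have Fb: "F i \<in> sets borel" for i by auto
    have "(\<Sum>i. \<integral>\<^sup>+x. emeasure N {y. x + y \<in> F i} \<partial>M)
        = (\<integral>\<^sup>+x. (\<Sum>i. emeasure N {y. x + y \<in> F i}) \<partial>M)"
      using measurable_translate_emeasure[OF N Fb] M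
      by (intro nn_integral_suminf[symmetric]) (simp cong: measurable_cong_sets)
    also have "\<dots> = (\<integral>\<^sup>+x. emeasure N {y. x + y \<in> (\<Union>i. F i)} \<partial>M)"
    proof (rule nn_integral_cong)
      fix x
      have "(\<Sum>i. emeasure N {y. x + y \<in> F i}) = emeasure N (\<Union>i. {y. x + y \<in> F i})"
        using F(2) translate_sets(1)[OF Fb] N(1)
        by (intro suminf_emeasure) (auto simp: disjoint_family_on_def)
      also have "(\<Union>i. {y. x + y \<in> F i}) = {y. x + y \<in> (\<Union>i. F i)}" by auto
      finally show "(\<Sum>i. emeasure N {y. x + y \<in> F i}) = emeasure N {y. x + y \<in> (\<Union>i. F i)}" .
    qed
    finally show "(\<Sum>i. \<integral>\<^sup>+x. emeasure N {y. x + y \<in> F i} \<partial>M)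
        = (\<integral>\<^sup>+x. emeasure N {y. x + y \<in> (\<Union>i. F i)} \<partial>M)" .
  qed
qed

lemma countably_supported_group_convolution:
  fixes M N :: "'a::{topological_group_add,t2_space} measure"
  assumes M: "sets M = sets borel" "countably_supported M"
    and N: "sets N = sets borel" "countably_supported N"
  shows "countably_supported (group_convolution M N)"
proof -
  obtain C D where C: "countable C" "AE x in M. x \<in> C" and D: "countable D" "AE x in N. x \<in> D"
    using M(2) N(2) by (auto simp: countably_supported_def)
  define E where "E = (\<lambda>(x, y). x + y) ` (C \<times> D)"
  have E: "countable E" using C(1) D(1) by (simp add: E_def)
  have Eb: "- E \<in> sets borel"
    using sets.countable[of E borel] E by (simp add: borel_comp)
  have "emeasure (group_convolution M N) (- E) = (\<integral>\<^sup>+x. emeasure N {y. x + y \<in> - E} \<partial>M)"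
    by (rule emeasure_group_convolution[OF M(1) N Eb])
  also have "\<dots> = (\<integral>\<^sup>+x. 0 \<partial>M)"
  proof (rule nn_integral_cong_AE, use C(2) in eventually_elim)
    fix x assume x: "x \<in> C"
    have "AE y in N. y \<notin> {y. x + y \<in> - E}"
      using D(2) by eventually_elim (use x in \<open>auto simp: E_def\<close>)
    then show "emeasure N {y. x + y \<in> - E} = 0"
      using translate_sets(1)[OF Eb, of x] N(1) sets_eq_imp_space_eq[OF N(1)]
      by (intro AE_iff_measurable[THEN iffD1, rotated 2]) auto
  qed
  finally have "- E \<in> null_sets (group_convolution M N)" using Eb by auto
  then have "AE x in group_convolution M N. x \<in> E" by (rule AE_I') auto
  then show ?thesis using E by (auto simp: countably_supported_def)
qed

lemma prob_space_group_convolution: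
  fixes M N :: "'a::{topological_group_add,t2_space} measure"
  assumes M: "sets M = sets borel" "prob_space M"
    and N: "sets N = sets borel" "countably_supported N" "prob_space N"
  shows "prob_space (group_convolution M N)"
proof
  interpret M: prob_space M by fact
  interpret N: prob_space N by fact
  have sp: "space N = UNIV" "space M = UNIV" "space (group_convolution M N) = UNIV"
    using sets_eq_imp_space_eq[OF N(1)] sets_eq_imp_space_eq[OF M(1)]
      sets_eq_imp_space_eq[OF sets_group_convolution[of M N]] by simp_all
  show "emeasure (group_convolution M N) (space (group_convolution M N)) = 1"
    using emeasure_group_convolution[OF M(1) N(1,2), of UNIV] N.emeasure_space_1 M.emeasure_space_1
    by (simp add: sp)
qed

lemma conv_power_properties:
  fixes M :: "'a::{topological_group_add,t2_space} measure"
  assumes M: "sets M = sets borel" "countably_supported M" "prob_space M"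
  shows "sets (conv_power M n) = sets borel" "countably_supported (conv_power M n)"
    "prob_space (conv_power M n)"
proof -
  have "sets (conv_power M n) = sets borel \<and> countably_supported (conv_power M n)
      \<and> prob_space (conv_power M n)"
  proof (induction n)
    case 0
    have "AE x in return borel (0::'a). x \<in> {0}" by (subst AE_return) auto
    then have "countably_supported (return borel (0::'a))"
      unfolding countably_supported_def by (intro exI[of _ "{0}"]) simp
    then show ?case by (simp add: prob_space_return)
  next
    case (Suc n)
    then show ?case
      using M by (simp add: countably_supported_group_convolution prob_space_group_convolution)
  qed
  then show "sets (conv_power M n) = sets borel" "countably_supported (conv_power M n)"
    "prob_space (conv_power M n)" by auto
qed

end

theory Submission
  imports Defs
begin

text \<open>
  Amenability yields a finite set \<open>F\<close>, a probability vector \<open>\<mu>\<close> on \<open>F\<close> and, for each \<open>g\<close> in a finite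
  set carrying most of \<open>\<nu>\<close>, a fractional matching \<open>\<pi> g\<close> with both marginals at most \<open>\<mu>\<close> that is
  supported on the pairs \<open>(x, y)\<close> with \<open>x \<in> V + g + y\<close> and has total weight close to \<open>1\<close>. Otherwise
  linear programming duality on finite sets and compactness would produce fractional covers on the
  whole group; squeezing uniformly continuous functions between them gives a function
  \<open>\<Sum>g. h g x - h g (g + x)\<close> with a negative upper bound, on which every invariant mean vanishes.

  The matchings define a substochastic reversible kernel \<open>P\<close> on \<open>F\<close>. If \<open>V\<close> is conjugation invariant,
  an \<open>n\<close>-step path of \<open>P\<close> from \<open>x\<close> back to \<open>x\<close> forces the product of its labels into \<open>V\<^sup>n\<close>, so
  \<open>P\<^sup>n x x \<le> \<nu>\<^sup>n(U\<^sup>n)\<close>, whereas self-adjointness bounds the trace of \<open>P\<^sup>n\<close> from below by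
  \<open>\<theta>\<^sup>n / card F\<close> for \<open>n = 2\<^sup>k\<close>.
\<close>

subsection \<open>Linear alternatives\<close>

text \<open>Tychonoff's theorem for intervals. It serves the simplex of multipliers and, later, the
  space of candidate covers of the whole group.\<close>

lemma compact_function_box:
  fixes M :: "'i \<Rightarrow> real"
  shows "compact {f. \<forall>i. 0 \<le> f i \<and> f i \<le> M i}"
proof -
  have "compactin (product_topology (\<lambda>i. euclidean) UNIV) (PiE UNIV (\<lambda>i. {0..M i}))"
    by (simp add: compactin_PiE)
  moreover have "PiE UNIV (\<lambda>i. {0..M i}) = {f. \<forall>i. 0 \<le> f i \<and> f i \<le> M i}"
    by (auto simp: PiE_def extensional_def)
  ultimately show ?thesis
    by (simp add: euclidean_product_topology)
qed

text \<open>A quadratic upper bound for the squared positive part, touching it at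
  \<open>d = 0\<close>. It replaces a derivative in the variational argument below.\<close>

lemma max_zero_square_shift_le:
  fixes u d :: real
  shows "(max 0 (u + d))\<^sup>2 \<le> (max 0 u + d)\<^sup>2"
proof (cases "0 \<le> u")
  case False
  then show ?thesis by (cases "0 \<le> u + d") (auto simp: max_def intro!: power_mono)
qed (auto simp: max_def)

text \<open>Coordinates outside \<open>I\<close> are pinned to 0, so the simplex is a closed subset
  of a Tychonoff box.\<close>

lemma compact_simplex:
  fixes I :: "'i set"
  assumes "finite I"
  shows "compact {k :: 'i \<Rightarrow> real. (\<forall>i. 0 \<le> k i) \<and> (\<forall>i. i \<notin> I \<longrightarrow> k i = 0) \<and> sum k I = 1}"
    (is "compact ?S")
proof -
  have "closed ?S"
  proof (intro closed_Collect_conj closed_Collect_all)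
    have coord: "continuous_on UNIV (\<lambda>k :: 'i \<Rightarrow> real. k i)" for i
      by (rule continuous_on_product_coordinates)
    show "closed {k :: 'i \<Rightarrow> real. 0 \<le> k i}" for i
      by (intro closed_Collect_le continuous_on_const coord)
    show "closed {k :: 'i \<Rightarrow> real. i \<notin> I \<longrightarrow> k i = 0}" for i
      by (cases "i \<in> I") (simp_all add: closed_Collect_eq coord)
    show "closed {k :: 'i \<Rightarrow> real. sum k I = 1}"
      by (intro closed_Collect_eq continuous_on_sum continuous_on_const coord)
  qed
  moreover have "?S \<subseteq> {f. \<forall>i. 0 \<le> f i \<and> f i \<le> 1}"
  proof (clarify, intro conjI)
    fix k :: "'i \<Rightarrow> real" and i
    assume k: "\<forall>i. 0 \<le> k i" "\<forall>i. i \<notin> I \<longrightarrow> k i = 0" "sum k I = 1"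
    show "0 \<le> k i" using k by simp
    show "k i \<le> 1" using member_le_sum[of i I k] assms k by (cases "i \<in> I") auto
  qed
  ultimately show ?thesis
    using compact_Int_closed[OF compact_function_box, of ?S "\<lambda>_. 1"] by (simp only: inf.absorb2)
qed

text \<open>The multipliers are the positive parts of the constraints at a minimiser of the sum of
  their squares.\<close>

lemma theorem_of_the_alternative:
  fixes c :: "'j \<Rightarrow> 'i \<Rightarrow> real"
  assumes I: "finite I" and J: "finite J"
  shows "(\<exists>k. (\<forall>i\<in>I. 0 \<le> k i) \<and> (\<Sum>i\<in>I. k i) = 1 \<and> (\<forall>j\<in>J. (\<Sum>i\<in>I. c j i * k i) \<le> 0)) \<or>
         (\<exists>l. (\<forall>j\<in>J. 0 \<le> l j) \<and> (\<forall>i\<in>I. 0 < (\<Sum>j\<in>J. l j * c j i)))"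
proof (cases "I = {}")
  case True
  then show ?thesis by (intro disjI2 exI[of _ "\<lambda>_. 0"]) auto
next
  case False
  then obtain i0 where i0: "i0 \<in> I" by auto
  define S where "S = {k :: 'i \<Rightarrow> real. (\<forall>i. 0 \<le> k i) \<and> (\<forall>i. i \<notin> I \<longrightarrow> k i = 0) \<and> sum k I = 1}"
  define L where "L j k = (\<Sum>i\<in>I. c j i * k i)" for j k
  define g where "g k = (\<Sum>j\<in>J. (max 0 (L j k))\<^sup>2)" for k
  have vertex: "(\<lambda>i'. if i' = i then 1 else 0) \<in> S" if "i \<in> I" for i
    using that I by (auto simp: S_def)
  have "compact S" unfolding S_def by (rule compact_simplex[OF I])
  moreover have "continuous_on S g"
    unfolding g_def L_def
    by (intro continuous_intros continuous_on_subset[OF continuous_on_product_coordinates]) auto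
  ultimately obtain p where p: "p \<in> S" and pmin: "\<And>k. k \<in> S \<Longrightarrow> g p \<le> g k"
    using continuous_attains_inf[of S g] vertex[OF i0] by blast
  show ?thesis
  proof (cases "g p = 0")
    case True
    then have "max 0 (L j p) = 0" if "j \<in> J" for j
      using that J by (simp add: g_def sum_nonneg_eq_0_iff)
    then have "L j p \<le> 0" if "j \<in> J" for j using that by (metis max.cobounded2)
    with p show ?thesis by (intro disjI1 exI[of _ p]) (auto simp: S_def L_def)
  next
    case False
    then have gp: "g p > 0" by (simp add: g_def sum_nonneg order_less_le)
    define l where "l j = max 0 (L j p)" for j
    have "0 < (\<Sum>j\<in>J. l j * c j i)" if i: "i \<in> I" for i
    proof -
      \<comment> \<open>To first order, moving from \<open>p\<close> towards the vertex
        \<open>i\<close> changes the constraint \<open>L j\<close> at rate \<open>d j\<close>, and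
        half the derivative of \<open>g\<close> is \<open>X\<close>.\<close>
      define d where "d j = c j i - L j p" for j
      define X where "X = (\<Sum>j\<in>J. l j * d j)"
      define Y where "Y = (\<Sum>j\<in>J. (d j)\<^sup>2)"
      have Y: "Y \<ge> 0" by (simp add: Y_def sum_nonneg)
      have ineq: "0 \<le> 2 * X + t * Y" if t: "0 < t" "t \<le> 1" for t
      proof -
        define k where "k = (\<lambda>i'. (1 - t) * p i' + t * (if i' = i then 1 else 0))"
        have "k \<in> S"
          using p t vertex[OF i] by (auto simp: S_def k_def sum.distrib simp flip: sum_distrib_left)
        have "L j k = (\<Sum>i'\<in>I. (1 - t) * (c j i' * p i') + t * (if i' = i then c j i' else 0))" for j
          unfolding L_def k_def by (intro sum.cong) (auto simp: algebra_simps)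
        then have Lk: "L j k = L j p + t * d j" for j
          using i I
          by (simp only: sum.distrib sum_distrib_left[symmetric] sum.delta if_True d_def)
             (simp add: L_def algebra_simps)
        have "g p \<le> g k" by (rule pmin) fact
        also have "\<dots> \<le> (\<Sum>j\<in>J. (l j + t * d j)\<^sup>2)"
          unfolding g_def Lk l_def by (intro sum_mono max_zero_square_shift_le)
        also have "\<dots> = (\<Sum>j\<in>J. (l j)\<^sup>2 + (2 * t) * (l j * d j) + t\<^sup>2 * (d j)\<^sup>2)"
          by (intro sum.cong refl) (simp add: power2_eq_square algebra_simps)
        also have "\<dots> = g p + (2 * t) * X + t\<^sup>2 * Y"
          by (simp only: sum.distrib g_def l_def X_def Y_def sum_distrib_left)
        finally have "0 \<le> t * (2 * X + t * Y)"
          by (simp add: power2_eq_square algebra_simps)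
        then show ?thesis using t by (simp add: zero_le_mult_iff)
      qed
      have "X \<ge> 0"
      proof (rule ccontr)
        assume neg: "\<not> 0 \<le> X"
        \<comment> \<open>This \<open>t\<close> gives \<open>t * Y \<le> - X - t\<close>, hence
          \<open>2 * X + t * Y \<le> X - t < 0\<close>, against \<open>ineq\<close>.\<close>
        define t where "t = min 1 (- X / (Y + 1))"
        have t: "0 < t" "t \<le> 1" "t \<le> - X / (Y + 1)" using neg Y by (auto simp: t_def divide_neg_pos)
        then have "t * (Y + 1) \<le> - X" using Y by (simp add: field_simps)
        with ineq[OF t(1,2)] t neg show False by (simp add: algebra_simps)
      qed
      \<comment> \<open>Strictness comes from here: the desired sum equals
        \<open>X + g p\<close>.\<close>
      moreover have "(\<Sum>j\<in>J. l j * L j p) = g p"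
        unfolding g_def l_def by (intro sum.cong) (auto simp: max_def power2_eq_square)
      ultimately show ?thesis using gp
        by (simp add: X_def d_def right_diff_distrib sum_subtractf)
    qed
    moreover have "\<forall>j\<in>J. 0 \<le> l j" by (simp add: l_def)
    ultimately show ?thesis by blast
  qed
qed

subsection \<open>Uniformly continuous functions between two bounds\<close>

text \<open>A discrete intermediate value argument: \<open>k\<close> is an entry at which the
  partial sums pass \<open>t\<close>.\<close>

lemma split_list_at_sum:
  fixes f :: "'b \<Rightarrow> real"
  assumes "0 \<le> t" "t < sum_list (map f xs)"
  shows "\<exists>as k bs. xs = as @ k # bs \<and> sum_list (map f as) \<le> t \<and> t < sum_list (map f as) + f k"
  using assms
proof (induction xs arbitrary: t)
  case (Cons x xs)
  show ?case
  proof (cases "t < f x")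
    case True
    with Cons.prems show ?thesis by (intro exI[of _ "[]"]) auto
  next
    case False
    with Cons.prems Cons.IH[of "t - f x"] obtain as k bs where
      "xs = as @ k # bs" "sum_list (map f as) \<le> t - f x" "t - f x < sum_list (map f as) + f k"
      by auto
    then show ?thesis by (intro exI[of _ "x # as"] exI[of _ k] exI[of _ bs]) auto
  qed
qed simp

text \<open>Words stand in for chains of neighbourhoods. With weight \<open>(1/2) ^ n\<close> for
  the letter \<open>n\<close>, the least weight of a word reaching a point plays the role of its
  distance from the identity.\<close>

primrec nbhd_word :: "(nat \<Rightarrow> 'a::monoid_add set) \<Rightarrow> nat list \<Rightarrow> 'a set" where
  "nbhd_word V [] = {0}"
| "nbhd_word V (n # ns) = {v + x | v x. v \<in> V n \<and> x \<in> nbhd_word V ns}"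

lemma nbhd_word_append:
  "nbhd_word V (as @ bs) = {x + y | x y. x \<in> nbhd_word V as \<and> y \<in> nbhd_word V bs}"
proof (induction as)
  case (Cons n as)
  show ?case by (simp add: Cons) (metis (no_types, opaque_lifting) add.assoc)
qed simp

text \<open>The Birkhoff--Kakutani estimate: cut a word in the middle of its weight.\<close>

lemma nbhd_word_subset:
  fixes V :: "nat \<Rightarrow> 'a::monoid_add set"
  assumes zero: "\<And>n. 0 \<in> V n"
    and triple: "\<And>n x y z. \<lbrakk>x \<in> V (Suc n); y \<in> V (Suc n); z \<in> V (Suc n)\<rbrakk> \<Longrightarrow> x + y + z \<in> V n"
  shows "(\<Sum>n\<leftarrow>ns. (1/2) ^ n) < (1/2 :: real) ^ m \<Longrightarrow> nbhd_word V ns \<subseteq> V m"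
proof (induction "length ns" arbitrary: ns m rule: less_induct)
  case less
  have decreasing: "V n \<subseteq> V m" if "m \<le> n" for m n
    using that
  proof (induction rule: dec_induct)
    case (step n)
    have "V (Suc n) \<subseteq> V n" using triple[OF _ zero zero] by auto
    with step show ?case by blast
  qed simp
  let ?s = "\<lambda>ns. \<Sum>n\<leftarrow>ns. (1/2 :: real) ^ n"
  have s_nonneg: "?s ns \<ge> 0" for ns by (intro sum_list_nonneg) auto
  show ?case
  proof (cases ns)
    case Nil
    then show ?thesis using zero by simp
  next
    case (Cons n0 ns0)
    then have pos: "?s ns > 0" using s_nonneg[of ns0] by (auto intro: add_pos_nonneg)
    \<comment> \<open>Both outer pieces weigh at most half of the total, hence less than
      \<open>(1/2) ^ Suc m\<close>, and are shorter, so the induction hypothesis covers them; only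
      the letter \<open>k\<close> remains.\<close>
    then obtain as k bs where ns: "ns = as @ k # bs" and
      as: "?s as \<le> ?s ns / 2" "?s ns / 2 < ?s as + (1/2) ^ k"
      using split_list_at_sum[of "?s ns / 2" "\<lambda>n. (1/2) ^ n" ns] by auto
    have "?s bs < ?s ns / 2" using as(2) by (simp add: ns)
    then have "nbhd_word V bs \<subseteq> V (Suc m)" using less.prems by (intro less.hyps) (auto simp: ns)
    moreover have "nbhd_word V as \<subseteq> V (Suc m)"
      using as(1) less.prems by (intro less.hyps) (auto simp: ns)
    moreover have "V k \<subseteq> V (Suc m)"
    proof (rule decreasing, rule ccontr)
      \<comment> \<open>A letter \<open>k \<le> m\<close> would by itself already weigh
        \<open>(1/2) ^ m\<close>.\<close>
      assume "\<not> Suc m \<le> k"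
      then have "(1/2 :: real) ^ m \<le> (1/2) ^ k" by (intro power_decreasing) auto
      also have "\<dots> \<le> ?s ns" using s_nonneg[of as] s_nonneg[of bs] by (simp add: ns)
      finally show False using less.prems by simp
    qed
    ultimately show ?thesis
      using triple[of _ m] unfolding ns nbhd_word_append by (force simp: add.assoc)
  qed
qed

text \<open>Continuity of addition at the identity, used twice, handles three summands; intersecting
  with the set of negatives gives symmetry.\<close>

lemma identity_nhds_symmetric_triple:
  fixes U :: "'a::topological_group_add set"
  assumes "U \<in> identity_nhds"
  shows "\<exists>W\<in>identity_nhds. (\<forall>x\<in>W. - x \<in> W) \<and> (\<forall>x\<in>W. \<forall>y\<in>W. \<forall>z\<in>W. x + y + z \<in> U) \<and> W \<subseteq> U"
proof -
  have half: "\<exists>W\<in>identity_nhds. \<forall>x\<in>W. \<forall>y\<in>W. x + y \<in> U" if "U \<in> identity_nhds" for U :: "'a set"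
  proof -
    have "((\<lambda>p. fst p + snd p) \<longlongrightarrow> 0 + 0) (nhds 0 \<times>\<^sub>F nhds (0::'a))"
      by (intro tendsto_add filterlim_fst filterlim_snd)
    then have "eventually (\<lambda>p. fst p + snd p \<in> U) (nhds 0 \<times>\<^sub>F nhds (0::'a))"
      using that by (auto simp: identity_nhds_def filterlim_iff)
    then obtain P where "eventually P (nhds (0::'a))" "\<And>x y. P x \<Longrightarrow> P y \<Longrightarrow> x + y \<in> U"
      unfolding eventually_prod_same by auto
    then show ?thesis by (intro bexI[of _ "Collect P"]) (auto simp: identity_nhds_def)
  qed
  obtain W1 where W1: "W1 \<in> identity_nhds" "\<forall>x\<in>W1. \<forall>y\<in>W1. x + y \<in> U" using half[OF assms] by auto
  obtain W2 where W2: "W2 \<in> identity_nhds" "\<forall>x\<in>W2. \<forall>y\<in>W2. x + y \<in> W1" using half[OF W1(1)] by auto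
  define W0 where "W0 = W1 \<inter> W2"
  define W where "W = {x. x \<in> W0 \<and> - x \<in> W0}"
  have W0: "eventually (\<lambda>x. x \<in> W0) (nhds 0)"
    using W1 W2 by (auto simp: identity_nhds_def W0_def eventually_conj)
  moreover have "eventually (\<lambda>x. - x \<in> W0) (nhds 0)"
    using eventually_compose_filterlim[OF W0, of uminus "nhds 0"] tendsto_uminus_nhds[of "0::'a"]
    by simp
  ultimately have "W \<in> identity_nhds" by (simp add: W_def identity_nhds_def eventually_conj)
  moreover have "0 \<in> W" using calculation by (auto simp: identity_nhds_def dest: eventually_nhds_x_imp_x)
  moreover have "x \<in> U" if "x \<in> W" for x
    using W1(2) that \<open>0 \<in> W\<close> by (force simp: W_def W0_def)
  ultimately show ?thesis
    using W1 W2 by (intro bexI[of _ W]) (auto simp: W_def W0_def)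
qed

text \<open>Dependent choice iterates the previous lemma; \<open>V n\<close> acts as a ball of
  radius about \<open>(1/2) ^ n\<close>.\<close>

lemma identity_nhds_chain:
  fixes U :: "'a::topological_group_add set"
  assumes "U \<in> identity_nhds"
  obtains V :: "nat \<Rightarrow> 'a set" where "V 0 \<subseteq> U" "\<And>n. V n \<in> identity_nhds"
    "\<And>n x. x \<in> V n \<Longrightarrow> - x \<in> V n"
    "\<And>n x y z. \<lbrakk>x \<in> V (Suc n); y \<in> V (Suc n); z \<in> V (Suc n)\<rbrakk> \<Longrightarrow> x + y + z \<in> V n"
proof -
  define P where "P = (\<lambda>(n::nat) W. W \<in> identity_nhds \<and> (\<forall>x\<in>W. - x \<in> W) \<and> W \<subseteq> (if n = 0 then U else UNIV))"
  define Q where "Q = (\<lambda>(n::nat) W W'. \<forall>x\<in>W'. \<forall>y\<in>W'. \<forall>z\<in>W'. x + y + z \<in> (W :: 'a set))"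
  have "\<exists>V. \<forall>n. P n (V n) \<and> Q n (V n) (V (Suc n))"
  proof (rule dependent_nat_choice)
    show "\<exists>W. P 0 W" using identity_nhds_symmetric_triple[OF assms] by (auto simp: P_def)
    show "\<exists>W'. P (Suc n) W' \<and> Q n W W'" if "P n W" for W n
      using identity_nhds_symmetric_triple[of W] that by (auto simp: P_def Q_def)
  qed
  then obtain V where "\<And>n. P n (V n)" "\<And>n. Q n (V n) (V (Suc n))" by auto
  then show ?thesis by (intro that[of V]) (fastforce simp: P_def Q_def split: if_splits)+
qed

text \<open>An insertion theorem: \<open>h z\<close> is the infimum of \<open>a x\<close> plus the
  weight of a word leading from \<open>x\<close> to \<open>z\<close>. The empty word gives
  \<open>h \<le> a\<close>. A word of weight below 1 stays in \<open>U\<close>, where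
  \<open>le\<close> applies, and a heavier one costs at least \<open>1 \<ge> c z\<close>; so
  \<open>c \<le> h\<close>. One more letter \<open>n\<close> costs \<open>(1/2) ^ n\<close>, which
  gives uniform continuity.\<close>

lemma RUCB_between:
  fixes a c :: "'a::topological_group_add \<Rightarrow> real"
  assumes U: "U \<in> identity_nhds"
    and a: "\<And>x. 0 \<le> a x" and c: "\<And>x. c x \<le> 1" and B: "\<And>x. 0 \<le> c x" "\<And>x. a x \<le> B"
    and le: "\<And>x z. x - z \<in> U \<Longrightarrow> c z \<le> a x"
  shows "\<exists>h\<in>RUCB. (\<forall>x. c x \<le> h x) \<and> (\<forall>x. h x \<le> a x)"
proof -
  obtain V :: "nat \<Rightarrow> 'a set" where V0: "V 0 \<subseteq> U" and Vn: "\<And>n. V n \<in> identity_nhds"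
    and sym: "\<And>n x. x \<in> V n \<Longrightarrow> - x \<in> V n"
    and triple: "\<And>n x y z. \<lbrakk>x \<in> V (Suc n); y \<in> V (Suc n); z \<in> V (Suc n)\<rbrakk> \<Longrightarrow> x + y + z \<in> V n"
    using identity_nhds_chain[OF U] by blast
  have zero: "0 \<in> V n" for n
    using Vn[of n] by (auto simp: identity_nhds_def dest: eventually_nhds_x_imp_x)
  let ?s = "\<lambda>ns. \<Sum>n\<leftarrow>ns. (1/2 :: real) ^ n"
  define A where "A z = {a x + ?s ns | x ns. z - x \<in> nbhd_word V ns}" for z
  define h where "h z = Inf (A z)" for z
  have in_A: "a z \<in> A z" for z unfolding A_def by (rule CollectI, rule exI[of _ z], rule exI[of _ "[]"]) simp
  have ge_c: "c z \<le> t" if t: "t \<in> A z" for z t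
  proof -
    obtain x ns where t: "t = a x + ?s ns" and x: "z - x \<in> nbhd_word V ns"
      using t by (auto simp: A_def)
    show ?thesis
    proof (cases "?s ns < (1/2) ^ 0")
      case True
      then have "z - x \<in> V 0" using nbhd_word_subset[of V, OF zero triple] x by blast
      \<comment> \<open>\<open>le\<close> asks for \<open>x - z\<close>, whereas words measure
        \<open>z - x\<close>; symmetry of \<open>V 0\<close> reconciles the two.\<close>
      then have "- (z - x) \<in> U" using sym V0 by blast
      then have "c z \<le> a x" by (intro le) simp
      moreover have "?s ns \<ge> 0" by (intro sum_list_nonneg) auto
      ultimately show ?thesis by (simp add: t)
    next
      case False
      then show ?thesis using c[of z] a[of x] by (simp add: t)
    qed
  qed
  have bdd: "bdd_below (A z)" for z using ge_c by (meson bdd_belowI)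
  have h_a: "h z \<le> a z" for z unfolding h_def by (intro cInf_lower in_A bdd)
  have c_h: "c z \<le> h z" for z unfolding h_def using in_A ge_c by (intro cInf_greatest) auto
  have lip: "h (u + z) \<le> h z + (1/2) ^ n" if u: "u \<in> V n" for u z n
  proof -
    have "h (u + z) - (1/2) ^ n \<le> t" if t: "t \<in> A z" for t
    proof -
      obtain x ns where t: "t = a x + ?s ns" and x: "z - x \<in> nbhd_word V ns"
        using t by (auto simp: A_def)
      have "u + z - x \<in> nbhd_word V (n # ns)"
        unfolding nbhd_word.simps
        by (intro CollectI exI[of _ u] exI[of _ "z - x"] conjI u x) (simp add: add_diff_eq)
      then have "a x + ?s (n # ns) \<in> A (u + z)" unfolding A_def by blast
      then have "h (u + z) \<le> a x + ?s (n # ns)" unfolding h_def by (intro cInf_lower bdd)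
      then show ?thesis by (simp add: t)
    qed
    then have "h (u + z) - (1/2) ^ n \<le> h z" unfolding h_def[of z] using in_A by (intro cInf_greatest) auto
    then show ?thesis by simp
  qed
  have "h \<in> RUCB" unfolding RUCB_def
  proof (intro CollectI conjI allI impI)
    show "bounded (range h)" unfolding bounded_iff
    proof (intro exI[of _ B] ballI)
      fix y assume "y \<in> range h"
      then obtain z where "y = h z" by auto
      then show "norm y \<le> B" using c_h[of z] h_a[of z] B(1)[of z] B(2)[of z] by simp
    qed
    fix e :: real assume "e > 0"
    then obtain n where n: "(1/2 :: real) ^ n < e"
      using real_arch_pow_inv[of e "1/2"] by auto
    have "\<bar>h x - h (u + x)\<bar> \<le> e" if u: "u \<in> V n" for u x
      using lip[OF u, of x] lip[OF sym[OF u], of "u + x"] n by simp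
    then show "\<exists>U\<in>identity_nhds. \<forall>x. \<forall>y\<in>(\<lambda>u. u + x) ` U. \<bar>h x - h y\<bar> \<le> e"
      using Vn[of n] by blast
  qed
  with h_a c_h show ?thesis by blast
qed

subsection \<open>Invariant means and fractional covers\<close>

lemma RUCB_const: "(\<lambda>_. c) \<in> RUCB"
  unfolding RUCB_def identity_nhds_def by (auto intro!: exI[of _ UNIV])

lemma RUCB_nearby:
  assumes "f \<in> RUCB" "0 < e"
  shows "\<exists>U\<in>identity_nhds. \<forall>x. \<forall>u\<in>U. \<bar>f x - f (u + x)\<bar> \<le> e"
  using assms unfolding RUCB_def by auto

lemma RUCB_add:
  assumes f: "f \<in> RUCB" and h: "h \<in> RUCB"
  shows "(\<lambda>x. f x + h x) \<in> RUCB"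
  unfolding RUCB_def
proof (intro CollectI conjI allI impI)
  show "bounded (range (\<lambda>x. f x + h x))"
    using f h by (intro bounded_plus_comp) (auto simp: RUCB_def)
  fix e :: real assume "e > 0"
  then have e: "e / 2 > 0" by simp
  obtain U W where "U \<in> identity_nhds" "W \<in> identity_nhds"
    and U: "\<And>x u. u \<in> U \<Longrightarrow> \<bar>f x - f (u + x)\<bar> \<le> e / 2"
    and W: "\<And>x u. u \<in> W \<Longrightarrow> \<bar>h x - h (u + x)\<bar> \<le> e / 2"
    using RUCB_nearby[OF f e] RUCB_nearby[OF h e] by metis
  moreover from this have "U \<inter> W \<in> identity_nhds"
    by (auto simp: identity_nhds_def eventually_conj)
  moreover have "\<bar>(f x + h x) - (f (u + x) + h (u + x))\<bar> \<le> e" if "u \<in> U \<inter> W" for u x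
    using U[of u x] W[of u x] IntD1[OF that] IntD2[OF that] unfolding abs_le_iff by argo
  ultimately show "\<exists>U\<in>identity_nhds. \<forall>x. \<forall>y\<in>(\<lambda>u. u + x) ` U. \<bar>f x + h x - (f y + h y)\<bar> \<le> e"
    by blast
qed

lemma RUCB_cmult:
  assumes f: "f \<in> RUCB"
  shows "(\<lambda>x. c * f x) \<in> RUCB"
  unfolding RUCB_def
proof (intro CollectI conjI allI impI)
  show "bounded (range (\<lambda>x. c * f x))"
    using bounded_scaling[of "range f" c] f by (simp add: RUCB_def image_image)
  fix e :: real assume "e > 0"
  then have "e / (\<bar>c\<bar> + 1) > 0" by simp
  from RUCB_nearby[OF f this] obtain U where U: "U \<in> identity_nhds"
    "\<And>x u. u \<in> U \<Longrightarrow> \<bar>f x - f (u + x)\<bar> \<le> e / (\<bar>c\<bar> + 1)"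
    by metis
  have "\<bar>c * f x - c * f (u + x)\<bar> \<le> e" if "u \<in> U" for u x
  proof -
    have "\<bar>c * f x - c * f (u + x)\<bar> = \<bar>c\<bar> * \<bar>f x - f (u + x)\<bar>"
      by (simp add: abs_mult flip: right_diff_distrib)
    also have "\<dots> \<le> (\<bar>c\<bar> + 1) * (e / (\<bar>c\<bar> + 1))"
      using U(2)[OF that, of x] by (intro mult_mono) auto
    finally show ?thesis by simp
  qed
  with U(1) show "\<exists>U\<in>identity_nhds. \<forall>x. \<forall>y\<in>(\<lambda>u. u + x) ` U. \<bar>c * f x - c * f y\<bar> \<le> e"
    by blast
qed

text \<open>Left translation by \<open>g\<close> turns the perturbation \<open>u\<close> into its
  conjugate \<open>g + u - g\<close>, and conjugation by a fixed element is continuous at the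
  identity.\<close>

lemma RUCB_translate:
  fixes f :: "'a::topological_group_add \<Rightarrow> real"
  assumes f: "f \<in> RUCB"
  shows "f \<circ> (\<lambda>x. g + x) \<in> RUCB"
  unfolding RUCB_def
proof (intro CollectI conjI allI impI)
  show "bounded (range (f \<circ> (\<lambda>x. g + x)))"
    using f by (auto simp: RUCB_def intro: bounded_subset)
  fix e :: real assume "e > 0"
  then obtain U where U: "U \<in> identity_nhds" "\<And>x u. u \<in> U \<Longrightarrow> \<bar>f x - f (u + x)\<bar> \<le> e"
    using RUCB_nearby[OF f] by metis
  have "((\<lambda>u. g + u + - g) \<longlongrightarrow> g + 0 + - g) (nhds 0)"
    by (intro tendsto_add tendsto_const tendsto_ident_at filterlim_ident)
  then have "eventually (\<lambda>u. g + u + - g \<in> U) (nhds 0)"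
    using eventually_compose_filterlim[of "\<lambda>u. u \<in> U" "nhds 0"] U(1)
    by (auto simp: identity_nhds_def)
  then have "{u. g + u + - g \<in> U} \<in> identity_nhds" by (simp add: identity_nhds_def)
  moreover have "\<bar>f (g + x) - f (g + (u + x))\<bar> \<le> e" if "g + u + - g \<in> U" for u x
  proof -
    have "g + u + - g + (g + x) = g + (u + x)"
      by (simp only: add.assoc minus_add_cancel)
    then show ?thesis using U(2)[OF that, of "g + x"] by simp
  qed
  ultimately show "\<exists>U\<in>identity_nhds. \<forall>x. \<forall>y\<in>(\<lambda>u. u + x) ` U.
      \<bar>(f \<circ> (\<lambda>x. g + x)) x - (f \<circ> (\<lambda>x. g + x)) y\<bar> \<le> e"
    by (intro bexI[of _ "{u. g + u + - g \<in> U}"]) auto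
qed

lemma left_invariant_meanD:
  assumes "left_invariant_mean m"
  shows left_invariant_mean_add:
      "\<lbrakk>f \<in> RUCB; h \<in> RUCB\<rbrakk> \<Longrightarrow> m (\<lambda>x. f x + h x) = m f + m h"
    and left_invariant_mean_cmult: "f \<in> RUCB \<Longrightarrow> m (\<lambda>x. c * f x) = c * m f"
    and left_invariant_mean_nonneg: "\<lbrakk>f \<in> RUCB; \<And>x. 0 \<le> f x\<rbrakk> \<Longrightarrow> 0 \<le> m f"
    and left_invariant_mean_one: "m (\<lambda>_. 1) = 1"
    and left_invariant_mean_translate: "f \<in> RUCB \<Longrightarrow> m (f \<circ> (\<lambda>x. g + x)) = m f"
  using assms unfolding left_invariant_mean_def by blast+

lemma left_invariant_mean_const:
  assumes "left_invariant_mean m"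
  shows "m (\<lambda>_. c) = c"
  using left_invariant_mean_cmult[OF assms RUCB_const, of c 1] left_invariant_mean_one[OF assms]
  by simp

text \<open>Each summand is a function minus its left translate. Membership in \<open>RUCB\<close>
  is carried through the induction because additivity of \<open>m\<close> holds only there.\<close>

lemma left_invariant_mean_coboundary:
  fixes h :: "'g \<Rightarrow> 'a::topological_group_add \<Rightarrow> real" and t :: "'g \<Rightarrow> 'a"
  assumes m: "left_invariant_mean m" and h: "\<And>g. g \<in> E \<Longrightarrow> h g \<in> RUCB"
  shows "(\<lambda>x. \<Sum>g\<in>E. h g x - h g (t g + x)) \<in> RUCB \<and> m (\<lambda>x. \<Sum>g\<in>E. h g x - h g (t g + x)) = 0"
  using h
proof (induction E rule: infinite_finite_induct)
  case (insert g E)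
  let ?f = "\<lambda>x. \<Sum>g\<in>E. h g x - h g (t g + x)" and ?k = "\<lambda>x. - 1 * (h g \<circ> (\<lambda>x. t g + x)) x"
  have f: "?f \<in> RUCB" "m ?f = 0" using insert by auto
  have hg: "h g \<in> RUCB" using insert by auto
  have k: "?k \<in> RUCB" by (intro RUCB_cmult RUCB_translate hg)
  have "m ?k = - 1 * m (h g \<circ> (\<lambda>x. t g + x))"
    by (rule left_invariant_mean_cmult[OF m RUCB_translate[OF hg]])
  also have "m (h g \<circ> (\<lambda>x. t g + x)) = m (h g)"
    by (rule left_invariant_mean_translate[OF m hg])
  finally have mk: "m ?k = - m (h g)" by simp
  have hk: "(\<lambda>x. h g x + ?k x) \<in> RUCB" by (intro RUCB_add hg k)
  have "m (\<lambda>x. (h g x + ?k x) + ?f x) = (m (h g) + m ?k) + m ?f"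
    using left_invariant_mean_add[OF m hk f(1)] left_invariant_mean_add[OF m hg k] by simp
  moreover have "(\<lambda>x. (h g x + ?k x) + ?f x) \<in> RUCB" by (intro RUCB_add hk f)
  ultimately show ?case using insert.hyps f(2) mk by (simp add: comp_def)
next
  \<comment> \<open>A sum over an infinite set is 0 by convention, leaving the zero
    function.\<close>
  case (infinite E)
  then show ?case by (simp add: RUCB_const left_invariant_mean_const[OF m])
next
  case empty
  show ?case by (simp add: RUCB_const left_invariant_mean_const[OF m])
qed

text \<open>Weak duality tested against an invariant mean. A function \<open>h g\<close> fits
  between \<open>w g - b g (- g + x)\<close> and \<open>a g x\<close>, so the sum of the
  \<open>h g x - h g (g + x)\<close> is at most \<open>\<theta> - sum w E\<close> everywhere, while
  its mean is 0.\<close>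

lemma amenable_cover_weight:
  fixes a b :: "'a::topological_group_add \<Rightarrow> 'a \<Rightarrow> real"
  assumes amen: "amenable_group TYPE('a)" and V: "V \<in> identity_nhds"
    and w1: "\<And>g. w g \<le> 1"
    and a: "\<And>g x. 0 \<le> a g x" "\<And>g x. a g x \<le> w g" and b: "\<And>g x. 0 \<le> b g x" "\<And>g x. b g x \<le> w g"
    and cover: "\<And>g x y. g \<in> E \<Longrightarrow> x - (g + y) \<in> V \<Longrightarrow> w g \<le> a g x + b g y"
    and bound: "\<And>x. (\<Sum>g\<in>E. a g x + b g x) \<le> \<theta>"
  shows "sum w E \<le> \<theta>"
proof -
  obtain m :: "('a \<Rightarrow> real) \<Rightarrow> real" where m: "left_invariant_mean m"
    using amen by (auto simp: amenable_group_def)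
  have "\<exists>h\<in>RUCB. (\<forall>x. w g - b g (- g + x) \<le> h x) \<and> (\<forall>x. h x \<le> a g x)" if "g \<in> E" for g
  proof (rule RUCB_between[OF V])
    \<comment> \<open>The cover condition with \<open>y = - g + z\<close>, so that
      \<open>x - (g + y) = x - z\<close>.\<close>
    show "w g - b g (- g + z) \<le> a g x" if "x - z \<in> V" for x z
      using cover[OF \<open>g \<in> E\<close>, of x "- g + z"] that by (simp add: add.assoc[symmetric])
    show "w g - b g (- g + x) \<le> 1" for x using b(1)[of g "- g + x"] w1[of g] by simp
  qed (use a b in auto)
  then obtain h where hR: "\<And>g. g \<in> E \<Longrightarrow> h g \<in> RUCB"
    and h: "\<And>g x. g \<in> E \<Longrightarrow> w g - b g (- g + x) \<le> h g x" "\<And>g x. g \<in> E \<Longrightarrow> h g x \<le> a g x"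
    by metis
  let ?f = "\<lambda>x. \<Sum>g\<in>E. h g x - h g (g + x)"
  have f: "?f \<in> RUCB" "m ?f = 0" using left_invariant_mean_coboundary[OF m hR, of E "\<lambda>g. g"] by auto
  have nonneg: "0 \<le> (\<theta> - sum w E) + - 1 * ?f x" for x
  proof -
    have "?f x \<le> (\<Sum>g\<in>E. (a g x + b g x) - w g)"
    proof (rule sum_mono)
      fix g assume g: "g \<in> E"
      show "h g x - h g (g + x) \<le> (a g x + b g x) - w g"
        using h(1)[OF g, of "g + x"] h(2)[OF g, of x] by (simp add: add.assoc[symmetric])
    qed
    also have "\<dots> \<le> \<theta> - sum w E" using bound[of x] by (simp add: sum_subtractf)
    finally show ?thesis by simp
  qed
  have R: "(\<lambda>x. - 1 * ?f x) \<in> RUCB" by (rule RUCB_cmult[OF f(1)])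
  have "m (\<lambda>x. - 1 * ?f x) = 0"
    using left_invariant_mean_cmult[OF m f(1), of "- 1"] f(2) by simp
  then have "m (\<lambda>x. (\<theta> - sum w E) + - 1 * ?f x) = \<theta> - sum w E"
    using left_invariant_mean_add[OF m RUCB_const R] left_invariant_mean_const[OF m] by simp
  then show ?thesis
    using left_invariant_mean_nonneg[OF m RUCB_add[OF RUCB_const R] nonneg] by simp
qed

section \<open>Fractional covers and their compactness\<close>

text \<open>The linear programming dual of a fractional matching in a family of bipartite graphs
  indexed by \<open>g\<close>. The bounds are imposed for all \<open>g\<close> and \<open>x\<close>,
  beyond \<open>E\<close> and \<open>F\<close>, so that covers are points of a Tychonoff
  box.\<close>

definition fractional_cover ::
    "'x set \<Rightarrow> 'g set \<Rightarrow> ('g \<Rightarrow> 'x \<Rightarrow> 'x \<Rightarrow> bool) \<Rightarrow> ('g \<Rightarrow> real) \<Rightarrow> ('g \<Rightarrow> 'x \<Rightarrow> real) \<Rightarrow> ('g \<Rightarrow> 'x \<Rightarrow> real) \<Rightarrow> bool"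
  where "fractional_cover F E R w a b \<longleftrightarrow>
    (\<forall>g x. 0 \<le> a g x \<and> a g x \<le> w g \<and> 0 \<le> b g x \<and> b g x \<le> w g) \<and>
    (\<forall>g\<in>E. \<forall>x\<in>F. \<forall>y\<in>F. R g x y \<longrightarrow> w g \<le> a g x + b g y)"

text \<open>Finite intersection property: each pair of points imposes a closed condition, and
  finitely many pairs involve only a finite set \<open>F\<close>, on which \<open>fin\<close>
  supplies a solution.\<close>

lemma cover_compactness:
  fixes w :: "'g \<Rightarrow> real" and R :: "'g \<Rightarrow> 'x \<Rightarrow> 'x \<Rightarrow> bool"
  assumes fin: "\<And>F. finite F \<Longrightarrow>
      \<exists>a b. fractional_cover F E R w a b \<and> (\<forall>x\<in>F. (\<Sum>g\<in>E. a g x + b g x) \<le> \<theta>)"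
  shows "\<exists>a b. fractional_cover UNIV E R w a b \<and> (\<forall>x. (\<Sum>g\<in>E. a g x + b g x) \<le> \<theta>)"
proof -
  \<comment> \<open>The boolean index packs \<open>a\<close> (\<open>True\<close>) and
    \<open>b\<close> (\<open>False\<close>) into a single function.\<close>
  define S where "S = {f :: bool \<times> 'g \<times> 'x \<Rightarrow> real. \<forall>i. 0 \<le> f i \<and> f i \<le> w (fst (snd i))}"
  define K where "K p = {f :: bool \<times> 'g \<times> 'x \<Rightarrow> real.
      (\<forall>g. g \<in> E \<and> R g (fst p) (snd p) \<longrightarrow> w g \<le> f (True, g, fst p) + f (False, g, snd p)) \<and>
      (\<Sum>g\<in>E. f (True, g, fst p) + f (False, g, fst p)) \<le> \<theta>}" for p
  have "S \<inter> (\<Inter>p\<in>UNIV. K p) \<noteq> {}"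
  proof (rule compact_imp_fip_image)
    show "compact S" unfolding S_def by (rule compact_function_box)
    show "closed (K p)" for p
    proof -
      have coord: "continuous_on UNIV (\<lambda>k :: bool \<times> 'g \<times> 'x \<Rightarrow> real. k i)" for i
        by (rule continuous_on_product_coordinates)
      show ?thesis unfolding K_def
      proof (intro closed_Collect_conj closed_Collect_all)
        show "closed {f. g \<in> E \<and> R g (fst p) (snd p) \<longrightarrow> w g \<le> f (True, g, fst p) + f (False, g, snd p)}" for g
        proof (cases "g \<in> E \<and> R g (fst p) (snd p)")
          case True
          then show ?thesis by (simp add: closed_Collect_le continuous_on_add coord)
        next
          case False
          then have "{f. g \<in> E \<and> R g (fst p) (snd p)
              \<longrightarrow> w g \<le> f (True, g, fst p) + f (False, g, snd p)} = UNIV" by blast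
          then show ?thesis by simp
        qed
      qed (intro closed_Collect_le continuous_on_sum continuous_on_add continuous_on_const coord)
    qed
    fix P :: "('x \<times> 'x) set" assume "finite P"
    define F where "F = fst ` P \<union> snd ` P"
    have "finite F" using \<open>finite P\<close> by (simp add: F_def)
    from fin[OF this] obtain a b where ab: "fractional_cover F E R w a b"
      "\<forall>x\<in>F. (\<Sum>g\<in>E. a g x + b g x) \<le> \<theta>"
      by blast
    have "(\<lambda>(s, g, x). if s then a g x else b g x) \<in> S \<inter> (\<Inter>p\<in>P. K p)"
      using ab by (auto simp: S_def K_def F_def fractional_cover_def)
    then show "S \<inter> (\<Inter>p\<in>P. K p) \<noteq> {}" by blast
  qed
  then obtain f where "f \<in> S" "\<And>x y. f \<in> K (x, y)" by blast
  then have "0 \<le> f (s, g, x)" "f (s, g, x) \<le> w g"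
    "g \<in> E \<Longrightarrow> R g x y \<Longrightarrow> w g \<le> f (True, g, x) + f (False, g, y)"
    "(\<Sum>g\<in>E. f (True, g, x) + f (False, g, x)) \<le> \<theta>" for s g x y
    by (auto simp: S_def K_def)
  then have "fractional_cover UNIV E R w (\<lambda>g x. f (True, g, x)) (\<lambda>g x. f (False, g, x)) \<and>
      (\<forall>x. (\<Sum>g\<in>E. f (True, g, x) + f (False, g, x)) \<le> \<theta>)"
    unfolding fractional_cover_def by blast
  then show ?thesis by blast
qed

subsection \<open>Fractional matchings\<close>

lemma sum_triple_if:
  fixes f :: "'g \<times> 'x \<times> 'x \<Rightarrow> real"
  assumes "finite E" "finite F" and R: "R \<subseteq> E \<times> F \<times> F"
  shows "(\<Sum>p\<in>R. f p) = (\<Sum>g\<in>E. \<Sum>x\<in>F. \<Sum>y\<in>F. if (g, x, y) \<in> R then f (g, x, y) else 0)"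
proof -
  have "(\<Sum>p\<in>R. f p) = (\<Sum>p\<in>E \<times> F \<times> F. if p \<in> R then f p else 0)"
    using assms by (intro sum.mono_neutral_cong_left) (auto intro: finite_subset)
  then show ?thesis by (simp add: sum.cartesian_product)
qed

text \<open>Marginals are bounded for each \<open>g\<close> separately: divided by
  \<open>\<mu>\<close>, every \<open>\<pi> g\<close> with \<open>g\<close> in \<open>E\<close>
  becomes a substochastic kernel on \<open>F\<close>.\<close>

definition fractional_matching ::
    "'x set \<Rightarrow> 'g set \<Rightarrow> ('g \<Rightarrow> 'x \<Rightarrow> 'x \<Rightarrow> bool) \<Rightarrow> ('x \<Rightarrow> real) \<Rightarrow> ('g \<Rightarrow> 'x \<Rightarrow> 'x \<Rightarrow> real) \<Rightarrow> bool"
  where "fractional_matching F E R \<mu> \<pi> \<longleftrightarrow>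
    (\<forall>x. 0 \<le> \<mu> x) \<and> sum \<mu> F = 1 \<and> (\<forall>g x y. 0 \<le> \<pi> g x y) \<and> (\<forall>g x y. \<pi> g x y \<noteq> 0 \<longrightarrow> R g x y) \<and>
    (\<forall>g\<in>E. \<forall>x\<in>F. (\<Sum>y\<in>F. \<pi> g x y) \<le> \<mu> x) \<and> (\<forall>g\<in>E. \<forall>y\<in>F. (\<Sum>x\<in>F. \<pi> g x y) \<le> \<mu> y)"

lemma fractional_matchingD:
  assumes "fractional_matching F E R \<mu> \<pi>"
  shows "0 \<le> \<mu> x" "sum \<mu> F = 1" "0 \<le> \<pi> g x y" "\<pi> g x y \<noteq> 0 \<Longrightarrow> R g x y"
    and "\<lbrakk>g \<in> E; x \<in> F\<rbrakk> \<Longrightarrow> (\<Sum>y\<in>F. \<pi> g x y) \<le> \<mu> x"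
    and "\<lbrakk>g \<in> E; y \<in> F\<rbrakk> \<Longrightarrow> (\<Sum>x\<in>F. \<pi> g x y) \<le> \<mu> y"
  using assms unfolding fractional_matching_def by auto

text \<open>Linear programming duality: in the theorem of the alternative, the columns are the points of
  \<open>F\<close> (the unknown \<open>\<mu>\<close>) and the edges (the unknown \<open>\<pi>\<close>); the row \<open>None\<close> is the lower bound on the
  total weight.\<close>

lemma matching_or_cover:
  fixes w :: "'g \<Rightarrow> real" and R :: "'g \<Rightarrow> 'x \<Rightarrow> 'x \<Rightarrow> bool"
  assumes E: "finite E" and F: "finite F" and w: "\<And>g. 0 \<le> w g"
  shows "(\<exists>\<mu> \<pi>. fractional_matching F E R \<mu> \<pi> \<and>
        \<theta> \<le> (\<Sum>g\<in>E. \<Sum>x\<in>F. \<Sum>y\<in>F. w g * \<pi> g x y)) \<or>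
      (\<exists>a b. fractional_cover F E R w a b \<and> (\<forall>x\<in>F. (\<Sum>g\<in>E. a g x + b g x) \<le> \<theta>))"
    (is "?matching \<or> ?cover")
proof -
  define T where "T = {p \<in> E \<times> F \<times> F. R (fst p) (fst (snd p)) (snd (snd p))}"
  have T: "T \<subseteq> E \<times> F \<times> F" "finite T" using E F by (auto simp: T_def)
  define J :: "(bool \<times> 'g \<times> 'x) option set" where "J = insert None (Some ` (UNIV \<times> E \<times> F))"
  have J: "finite J" using E F by (simp add: J_def)
  \<comment> \<open>The row \<open>Some (s, g, x)\<close> bounds the marginal of
    \<open>\<pi> g\<close> at \<open>x\<close>: the first marginal if \<open>s\<close> holds, the
    second otherwise.\<close>
  define c :: "(bool \<times> 'g \<times> 'x) option \<Rightarrow> 'x + 'g \<times> 'x \<times> 'x \<Rightarrow> real" where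
    "c j i = (case j of
        None \<Rightarrow> (case i of Inl z \<Rightarrow> \<theta> | Inr (g', x', y') \<Rightarrow> - w g')
      | Some (s, g, x) \<Rightarrow> (case i of Inl z \<Rightarrow> - of_bool (x = z)
          | Inr (g', x', y') \<Rightarrow> of_bool (g = g') * of_bool (x = (if s then x' else y'))))" for j i
  have sum_J: "(\<Sum>j\<in>J. f j) = f None + (\<Sum>g\<in>E. \<Sum>x\<in>F. f (Some (True, g, x)) + f (Some (False, g, x)))"
    for f :: "(bool \<times> 'g \<times> 'x) option \<Rightarrow> real"
  proof -
    have "(\<Sum>j\<in>J. f j) = f None + (\<Sum>p\<in>UNIV \<times> E \<times> F. f (Some p))"
      using E F by (simp add: J_def sum.reindex)
    also have "(\<Sum>p\<in>UNIV \<times> E \<times> F. f (Some p)) = (\<Sum>s\<in>UNIV. \<Sum>g\<in>E. \<Sum>x\<in>F. f (Some (s, g, x)))"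
      by (simp add: sum.cartesian_product case_prod_beta)
    finally show ?thesis by (simp add: UNIV_bool sum.distrib add.commute)
  qed
  have sum_I: "(\<Sum>i\<in>F <+> T. f i) = (\<Sum>x\<in>F. f (Inl x)) + (\<Sum>p\<in>T. f (Inr p))"
    for f :: "'x + 'g \<times> 'x \<times> 'x \<Rightarrow> real"
    using F T by (simp add: sum.Plus)
  consider k where "\<forall>i\<in>F <+> T. 0 \<le> k i" "sum k (F <+> T) = 1" "\<forall>j\<in>J. (\<Sum>i\<in>F <+> T. c j i * k i) \<le> 0"
    | l where "\<forall>j\<in>J. 0 \<le> l j" "\<forall>i\<in>F <+> T. 0 < (\<Sum>j\<in>J. l j * c j i)"
    using theorem_of_the_alternative[of "F <+> T" J c] F T J by auto
  then show ?thesis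
  proof cases
    case (1 k)
    define \<pi> where "\<pi> g x y = (if (g, x, y) \<in> T then k (Inr (g, x, y)) else 0)" for g x y
    define \<mu> where "\<mu> x = (if x \<in> F then k (Inl x) else 0)" for x
    have \<mu>0: "0 \<le> \<mu> x" and \<pi>0: "0 \<le> \<pi> g x y" for g x y using 1(1) by (auto simp: \<mu>_def \<pi>_def)
    have total: "sum \<mu> F + (\<Sum>g\<in>E. \<Sum>x\<in>F. \<Sum>y\<in>F. \<pi> g x y) = 1"
      using 1(2) unfolding sum_I sum_triple_if[OF E F T(1)] by (simp add: \<mu>_def \<pi>_def)
    have vertex: "(\<Sum>z\<in>F. c (Some (s, g, x)) (Inl z) * k (Inl z)) = - \<mu> x" if "x \<in> F" for s g x
    proof -
      have "(\<Sum>z\<in>F. c (Some (s, g, x)) (Inl z) * k (Inl z)) = (\<Sum>z\<in>F. if x = z then - \<mu> z else 0)"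
        by (intro sum.cong) (auto simp: c_def \<mu>_def)
      then show ?thesis using that F by simp
    qed
    have row: "(\<Sum>y\<in>F. \<pi> g x y) \<le> \<mu> x" if "g \<in> E" "x \<in> F" for g x
    proof -
      have "(\<Sum>p\<in>T. c (Some (True, g, x)) (Inr p) * k (Inr p))
          = (\<Sum>g'\<in>E. \<Sum>x'\<in>F. \<Sum>y\<in>F. if g = g' then (if x = x' then \<pi> g' x' y else 0) else 0)"
        unfolding sum_triple_if[OF E F T(1)] by (intro sum.cong refl) (simp add: c_def \<pi>_def)
      also have "\<dots> = (\<Sum>g'\<in>E. if g = g' then (\<Sum>x'\<in>F. if x = x' then (\<Sum>y\<in>F. \<pi> g' x' y) else 0) else 0)"
        by (intro sum.cong refl) (auto intro!: sum.cong)
      also have "\<dots> = (\<Sum>y\<in>F. \<pi> g x y)"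
        using that E F by simp
      finally have "(\<Sum>i\<in>F <+> T. c (Some (True, g, x)) i * k i) = - \<mu> x + (\<Sum>y\<in>F. \<pi> g x y)"
        unfolding sum_I using that by (simp add: vertex)
      moreover have "Some (True, g, x) \<in> J" using that by (simp add: J_def)
      ultimately show ?thesis using 1(3) by force
    qed
    have col: "(\<Sum>x\<in>F. \<pi> g x y) \<le> \<mu> y" if "g \<in> E" "y \<in> F" for g y
    proof -
      have "(\<Sum>p\<in>T. c (Some (False, g, y)) (Inr p) * k (Inr p))
          = (\<Sum>g'\<in>E. \<Sum>x\<in>F. \<Sum>y'\<in>F. if g = g' then (if y = y' then \<pi> g' x y' else 0) else 0)"
        unfolding sum_triple_if[OF E F T(1)] by (intro sum.cong refl) (simp add: c_def \<pi>_def)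
      also have "\<dots> = (\<Sum>g'\<in>E. if g = g' then (\<Sum>x\<in>F. \<Sum>y'\<in>F. if y = y' then \<pi> g' x y' else 0) else 0)"
        by (intro sum.cong refl) (auto intro!: sum.cong)
      also have "\<dots> = (\<Sum>x\<in>F. \<pi> g x y)"
        using that E F by simp
      finally have "(\<Sum>i\<in>F <+> T. c (Some (False, g, y)) i * k i) = - \<mu> y + (\<Sum>x\<in>F. \<pi> g x y)"
        unfolding sum_I using that by (simp add: vertex)
      moreover have "Some (False, g, y) \<in> J" using that by (simp add: J_def)
      ultimately show ?thesis using 1(3) by force
    qed
    have weight: "\<theta> * sum \<mu> F \<le> (\<Sum>g\<in>E. \<Sum>x\<in>F. \<Sum>y\<in>F. w g * \<pi> g x y)"
    proof -
      have "(\<Sum>p\<in>T. c None (Inr p) * k (Inr p)) = (\<Sum>g\<in>E. \<Sum>x\<in>F. \<Sum>y\<in>F. - (w g * \<pi> g x y))"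
        unfolding sum_triple_if[OF E F T(1)] by (intro sum.cong refl) (simp add: c_def \<pi>_def)
      then have "(\<Sum>i\<in>F <+> T. c None i * k i)
          = \<theta> * sum \<mu> F - (\<Sum>g\<in>E. \<Sum>x\<in>F. \<Sum>y\<in>F. w g * \<pi> g x y)"
        unfolding sum_I by (simp add: c_def \<mu>_def sum_distrib_left sum_negf)
      moreover have "None \<in> J" by (simp add: J_def)
      ultimately show ?thesis using 1(3) by force
    qed
    \<comment> \<open>The alternative normalises \<open>\<mu>\<close> and \<open>\<pi>\<close> only
      jointly. Were \<open>\<mu>\<close> zero on \<open>F\<close>, the row bounds would annihilate
      \<open>\<pi>\<close> too, contradicting \<open>total\<close>; so rescaling by
      \<open>sum \<mu> F\<close> is possible.\<close>
    have pos: "sum \<mu> F > 0"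
    proof (rule ccontr)
      assume "\<not> 0 < sum \<mu> F"
      then have zero: "sum \<mu> F = 0" using \<mu>0 by (simp add: sum_nonneg order_antisym not_less)
      then have "\<mu> x = 0" if "x \<in> F" for x using \<mu>0 F that by (simp add: sum_nonneg_eq_0_iff)
      then have "(\<Sum>y\<in>F. \<pi> g x y) = 0" if "g \<in> E" "x \<in> F" for g x
        using row[OF that] that \<pi>0 by (simp add: sum_nonneg order_antisym)
      then show False using total zero by simp
    qed
    have ?matching
      unfolding fractional_matching_def
    proof (intro exI[of _ "\<lambda>x. \<mu> x / sum \<mu> F"] exI[of _ "\<lambda>g x y. \<pi> g x y / sum \<mu> F"] conjI)
      show "\<theta> \<le> (\<Sum>g\<in>E. \<Sum>x\<in>F. \<Sum>y\<in>F. w g * (\<pi> g x y / sum \<mu> F))"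
        using weight pos by (simp add: pos_le_divide_eq flip: sum_divide_distrib)
    qed (use pos \<mu>0 \<pi>0 row col in \<open>auto simp: divide_right_mono \<pi>_def T_def split: if_splits simp flip: sum_divide_distrib\<close>)
    then show ?thesis ..
  next
    case (2 l)
    have ?cover
    proof (cases "F = {}")
      case True
      then show ?thesis using w by (intro exI[of _ "\<lambda>_ _. 0"]) (auto simp: fractional_cover_def)
    next
      case False
      then obtain x0 where x0: "x0 \<in> F" by auto
      define t where "t = l None"
      have l0: "0 \<le> t" "\<And>s g x. g \<in> E \<Longrightarrow> x \<in> F \<Longrightarrow> 0 \<le> l (Some (s, g, x))"
        using 2(1) by (auto simp: J_def t_def)
      have point: "(\<Sum>g\<in>E. l (Some (True, g, x)) + l (Some (False, g, x))) < t * \<theta>" if "x \<in> F" for x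
      proof -
        have "0 < (\<Sum>j\<in>J. l j * c j (Inl x))" using 2(2) that by auto
        also have "\<dots> = t * \<theta> + (\<Sum>g\<in>E. \<Sum>z\<in>F. - (if z = x then l (Some (True, g, z)) + l (Some (False, g, z)) else 0))"
          unfolding sum_J t_def by (intro arg_cong2[where f = "(+)"] sum.cong refl) (auto simp: c_def)
        finally show ?thesis using that F by (simp add: sum_subtractf sum.distrib sum_negf)
      qed
      have edge: "t * w g < l (Some (True, g, x)) + l (Some (False, g, y))" if "(g, x, y) \<in> T" for g x y
      proof -
        have gxy: "g \<in> E" "x \<in> F" "y \<in> F" using that T by auto
        have "0 < (\<Sum>j\<in>J. l j * c j (Inr (g, x, y)))" using 2(2) that by auto
        also have "\<dots> = - (t * w g) + (\<Sum>g'\<in>E. if g' = g then (\<Sum>z\<in>F. if z = x then l (Some (True, g, z)) else 0)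
            + (\<Sum>z\<in>F. if z = y then l (Some (False, g, z)) else 0) else 0)"
          unfolding sum_J t_def sum.distrib[symmetric]
          by (intro arg_cong2[where f = "(+)"] sum.cong refl)
            (auto simp: c_def sum.distrib[symmetric] intro!: sum.cong sum.neutral)
        finally show ?thesis using gxy E F by simp
      qed
      have "0 \<le> (\<Sum>g\<in>E. l (Some (True, g, x0)) + l (Some (False, g, x0)))"
        using l0 x0 by (intro sum_nonneg add_nonneg_nonneg) auto
      \<comment> \<open>For \<open>t = 0\<close> the bound \<open>point\<close> would make a sum of
        nonnegative multipliers negative.\<close>
      then have t: "t > 0" using point[OF x0] l0(1) by (cases "t = 0") auto
      \<comment> \<open>Dividing by \<open>t\<close> gives a cover; truncation at \<open>w g\<close>
        preserves it, since a truncated entry alone already equals \<open>w g\<close>.\<close>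
      define a where "a s g x = (if g \<in> E \<and> x \<in> F then min (w g) (l (Some (s, g, x)) / t) else 0)" for s g x
      show ?thesis unfolding fractional_cover_def
      proof (rule exI[of _ "a True"], rule exI[of _ "a False"], intro conjI ballI allI impI)
        fix g x show "0 \<le> a True g x" "0 \<le> a False g x" "a True g x \<le> w g" "a False g x \<le> w g"
          using w l0 t by (auto simp: a_def)
      next
        fix g x y assume gxy: "g \<in> E" "x \<in> F" "y \<in> F" "R g x y"
        then have "t * w g < l (Some (True, g, x)) + l (Some (False, g, y))" by (intro edge) (simp add: T_def)
        then have "w g < l (Some (True, g, x)) / t + l (Some (False, g, y)) / t"
          using t by (simp add: field_simps)
        moreover have "0 \<le> l (Some (True, g, x)) / t" "0 \<le> l (Some (False, g, y)) / t"
          using l0 t gxy by auto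
        ultimately show "w g \<le> a True g x + a False g y" using gxy w[of g] by (simp add: a_def min_def)
      next
        fix x assume x: "x \<in> F"
        have "(\<Sum>g\<in>E. a True g x + a False g x) \<le> (\<Sum>g\<in>E. (l (Some (True, g, x)) + l (Some (False, g, x))) / t)"
          using x by (intro sum_mono) (auto simp: a_def add_divide_distrib intro!: add_mono)
        also have "\<dots> \<le> \<theta>"
          using point[OF x] t by (simp add: pos_divide_le_eq mult.commute flip: sum_divide_distrib)
        finally show "(\<Sum>g\<in>E. a True g x + a False g x) \<le> \<theta>" .
      qed
    qed
    then show ?thesis ..
  qed
qed

text \<open>If every finite \<open>F\<close> failed, duality would cover each finite set with the
  same \<open>\<theta>\<close>, compactness the whole group, and the mean would give
  \<open>sum w E \<le> \<theta>\<close>.\<close>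

lemma amenable_matching:
  fixes E V :: "'a::topological_group_add set" and w :: "'a \<Rightarrow> real"
  assumes amen: "amenable_group TYPE('a)" and V: "V \<in> identity_nhds"
    and E: "finite E" and w: "\<And>g. 0 \<le> w g" "\<And>g. w g \<le> 1" and \<theta>: "\<theta> < sum w E"
  shows "\<exists>F \<mu> \<pi>. finite F \<and> fractional_matching F E (\<lambda>g x y. x - (g + y) \<in> V) \<mu> \<pi> \<and>
    \<theta> \<le> (\<Sum>g\<in>E. \<Sum>x\<in>F. \<Sum>y\<in>F. w g * \<pi> g x y)"
    (is ?matching)
proof (rule ccontr)
  let ?R = "\<lambda>g x y. x - (g + y) \<in> V"
  assume no: "\<not> ?matching"
  have "\<exists>a b. fractional_cover F E ?R w a b \<and> (\<forall>x\<in>F. (\<Sum>g\<in>E. a g x + b g x) \<le> \<theta>)"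
    if "finite F" for F
  proof (rule disjE[OF matching_or_cover[where R = ?R, OF E that w(1)]])
    assume "\<exists>\<mu> \<pi>. fractional_matching F E ?R \<mu> \<pi> \<and> \<theta> \<le> (\<Sum>g\<in>E. \<Sum>x\<in>F. \<Sum>y\<in>F. w g * \<pi> g x y)"
    then have ?matching using that by (intro exI[of _ F]) simp
    with no show ?thesis ..
  qed auto
  then have "\<exists>a b. fractional_cover UNIV E ?R w a b \<and> (\<forall>x. (\<Sum>g\<in>E. a g x + b g x) \<le> \<theta>)"
    by (rule cover_compactness)
  then obtain a b where "fractional_cover UNIV E ?R w a b" "\<And>x. (\<Sum>g\<in>E. a g x + b g x) \<le> \<theta>"
    by blast
  then have "sum w E \<le> \<theta>"
    by (intro amenable_cover_weight[OF amen V w(2), where a = a and b = b])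
      (auto simp: fractional_cover_def)
  with \<theta> show False by simp
qed

subsection \<open>Return probabilities\<close>

primrec kernel_power :: "'x set \<Rightarrow> ('x \<Rightarrow> 'x \<Rightarrow> real) \<Rightarrow> nat \<Rightarrow> 'x \<Rightarrow> 'x \<Rightarrow> real" where
  "kernel_power F P 0 x y = of_bool (x = y)"
| "kernel_power F P (Suc n) x y = (\<Sum>z\<in>F. P x z * kernel_power F P n z y)"

lemma kernel_power_nonneg:
  assumes "\<And>x y. 0 \<le> P x y"
  shows "0 \<le> kernel_power F P n x y"
  by (induction n arbitrary: x) (auto intro!: sum_nonneg mult_nonneg_nonneg assms)

lemma kernel_power_add:
  assumes F: "finite F" and x: "x \<in> F"
  shows "kernel_power F P (m + n) x y = (\<Sum>z\<in>F. kernel_power F P m x z * kernel_power F P n z y)"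
  using x
proof (induction m arbitrary: x)
  case 0
  have "(\<Sum>z\<in>F. of_bool (x = z) * kernel_power F P n z y)
      = (\<Sum>z\<in>F. if x = z then kernel_power F P n z y else 0)"
    by (intro sum.cong) auto
  then show ?case using 0 F by simp
next
  case (Suc m)
  have "kernel_power F P (Suc m + n) x y
      = (\<Sum>u\<in>F. \<Sum>z\<in>F. P x u * (kernel_power F P m u z * kernel_power F P n z y))"
    by (simp add: Suc.IH sum_distrib_left)
  also have "\<dots> = (\<Sum>z\<in>F. \<Sum>u\<in>F. P x u * (kernel_power F P m u z * kernel_power F P n z y))"
    by (rule sum.swap)
  finally show ?case by (simp add: sum_distrib_right mult.assoc)
qed

text \<open>Detailed balance passes to powers. Unfolding splits off the first step, which is the
  last one of the reversed path; \<open>kernel_power_add\<close> moves it there.\<close>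

lemma kernel_power_reversible:
  assumes F: "finite F" and rev: "\<And>x y. x \<in> F \<Longrightarrow> y \<in> F \<Longrightarrow> \<mu> x * P x y = \<mu> y * P y x"
    and "x \<in> F" "y \<in> F"
  shows "\<mu> x * kernel_power F P n x y = \<mu> y * kernel_power F P n y x"
  using assms(3,4)
proof (induction n arbitrary: x y)
  case (Suc n)
  have one: "kernel_power F P (Suc 0) z x = P z x" for z
  proof -
    have "(\<Sum>u\<in>F. P z u * of_bool (u = x)) = (\<Sum>u\<in>F. if u = x then P z u else 0)"
      by (intro sum.cong) auto
    then show ?thesis using F Suc.prems by simp
  qed
  have "\<mu> x * kernel_power F P (Suc n) x y = (\<Sum>z\<in>F. (\<mu> x * P x z) * kernel_power F P n z y)"
    by (simp add: sum_distrib_left mult.assoc)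
  also have "\<dots> = (\<Sum>z\<in>F. P z x * (\<mu> z * kernel_power F P n z y))"
    using Suc.prems by (intro sum.cong) (simp_all add: rev mult_ac)
  also have "\<dots> = (\<Sum>z\<in>F. \<mu> y * (kernel_power F P n y z * kernel_power F P (Suc 0) z x))"
    unfolding one using Suc by (intro sum.cong) (simp_all add: mult_ac)
  also have "\<dots> = \<mu> y * kernel_power F P (n + Suc 0) y x"
    unfolding kernel_power_add[OF F Suc.prems(2)] by (simp only: sum_distrib_left)
  finally show ?case by simp
qed auto

text \<open>Writing \<open>A\<^sub>n\<close> for the weight of the \<open>n\<close>-step paths started from \<open>\<mu>\<close>, self-adjointness gives
  \<open>A\<^sub>n\<^sup>2 \<le> A\<^sub>2\<^sub>n\<close>, and \<open>A\<^sub>2\<^sub>n\<close> is controlled by the trace.\<close>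

lemma reversible_trace_bound:
  fixes P :: "'x \<Rightarrow> 'x \<Rightarrow> real"
  assumes F: "finite F" and \<mu>: "\<And>x. 0 \<le> \<mu> x" "sum \<mu> F = 1" and P: "\<And>x y. 0 \<le> P x y"
    and rev: "\<And>x y. x \<in> F \<Longrightarrow> y \<in> F \<Longrightarrow> \<mu> x * P x y = \<mu> y * P y x"
    and \<theta>: "0 \<le> \<theta>" "\<theta> \<le> (\<Sum>x\<in>F. \<Sum>y\<in>F. \<mu> x * P x y)"
  shows "\<theta> ^ 2 ^ Suc k \<le> card F * (\<Sum>x\<in>F. kernel_power F P (2 ^ Suc k) x x)"
proof -
  let ?K = "kernel_power F P"
  define u where "u n x = (\<Sum>y\<in>F. ?K n x y)" for n x
  define A where "A n = (\<Sum>x\<in>F. \<mu> x * u n x)" for n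
  have K_rev: "\<mu> x * ?K n x y = \<mu> y * ?K n y x" if "x \<in> F" "y \<in> F" for n x y
    by (rule kernel_power_reversible[OF F rev that])
  \<comment> \<open>Reversibility turns the first half of each path around, making
    \<open>A (n + n)\<close> the squared norm of \<open>u n\<close> in L2 of
    \<open>\<mu>\<close>.\<close>
  have A2: "A (n + n) = (\<Sum>z\<in>F. \<mu> z * (u n z)\<^sup>2)" for n
  proof -
    have "A (n + n) = (\<Sum>x\<in>F. \<Sum>y\<in>F. \<Sum>z\<in>F. \<mu> x * ?K n x z * ?K n z y)"
      unfolding A_def u_def
      by (intro sum.cong refl) (simp add: kernel_power_add[OF F] sum_distrib_left mult.assoc)
    also have "\<dots> = (\<Sum>x\<in>F. \<Sum>z\<in>F. \<mu> x * ?K n x z * u n z)"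
      unfolding u_def sum_distrib_left by (intro sum.cong refl sum.swap)
    also have "\<dots> = (\<Sum>x\<in>F. \<Sum>z\<in>F. \<mu> z * ?K n z x * u n z)"
      by (intro sum.cong refl) (simp add: K_rev)
    also have "\<dots> = (\<Sum>z\<in>F. \<mu> z * (u n z)\<^sup>2)"
      unfolding power2_eq_square
      by (subst sum.swap, intro sum.cong refl) (simp add: u_def sum_distrib_left sum_distrib_right mult_ac)
    finally show ?thesis .
  qed
  have square: "(A n)\<^sup>2 \<le> A (n + n)" for n
  proof -
    \<comment> \<open>The variance of \<open>u n\<close> under the probability vector
      \<open>\<mu>\<close>.\<close>
    have "0 \<le> (\<Sum>x\<in>F. \<mu> x * (u n x - A n)\<^sup>2)" by (intro sum_nonneg mult_nonneg_nonneg \<mu>) auto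
    also have "\<dots> = (\<Sum>x\<in>F. \<mu> x * (u n x)\<^sup>2 - (2 * A n) * (\<mu> x * u n x) + (A n)\<^sup>2 * \<mu> x)"
      by (intro sum.cong refl) (simp add: power2_eq_square algebra_simps)
    also have "\<dots> = A (n + n) - (2 * A n) * A n + (A n)\<^sup>2 * sum \<mu> F"
      by (simp only: sum.distrib sum_subtractf A2 sum_distrib_left[symmetric] A_def[of n, symmetric])
    finally show ?thesis by (simp add: \<mu> power2_eq_square)
  qed
  have lower: "\<theta> ^ 2 ^ k \<le> A (2 ^ k)" for k
  proof (induction k)
    case 0
    have "u 1 x = (\<Sum>y\<in>F. P x y)" for x
    proof -
      have "u 1 x = (\<Sum>y\<in>F. \<Sum>z\<in>F. if z = y then P x z else 0)"
        unfolding u_def by (intro sum.cong refl) (auto intro!: sum.cong)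
      then show ?thesis using F by simp
    qed
    then show ?case using \<theta> by (simp add: A_def sum_distrib_left)
  next
    case (Suc k)
    have "\<theta> ^ 2 ^ Suc k = (\<theta> ^ 2 ^ k)\<^sup>2" by (simp add: mult.commute flip: power_mult)
    also have "\<dots> \<le> (A (2 ^ k))\<^sup>2" using Suc \<theta> by (intro power_mono) auto
    also have "\<dots> \<le> A (2 ^ k + 2 ^ k)" by (rule square)
    finally show ?case by (simp add: mult_2)
  qed
  have \<mu>1: "\<mu> x \<le> 1" if "x \<in> F" for x
    using member_le_sum[of x F \<mu>] \<mu> F that by auto
  have trace: "A (n + n) \<le> card F * (\<Sum>x\<in>F. ?K (n + n) x x)" for n
  proof -
    \<comment> \<open>Reversibility transposes one factor and leaves \<open>\<mu> y \<le> 1\<close>,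
      so squares become terms of the trace.\<close>
    have "\<mu> z * (?K n z y)\<^sup>2 \<le> ?K n z y * ?K n y z" if "z \<in> F" "y \<in> F" for z y
    proof -
      have "\<mu> z * (?K n z y)\<^sup>2 = \<mu> y * (?K n y z * ?K n z y)"
        using K_rev[OF that] by (simp add: power2_eq_square mult_ac)
      also have "\<dots> \<le> 1 * (?K n y z * ?K n z y)"
        using \<mu>1[OF that(2)] by (intro mult_right_mono mult_nonneg_nonneg kernel_power_nonneg P)
      finally show ?thesis by (simp add: mult.commute)
    qed
    then have "(\<Sum>z\<in>F. \<Sum>y\<in>F. \<mu> z * (?K n z y)\<^sup>2) \<le> (\<Sum>z\<in>F. \<Sum>y\<in>F. ?K n z y * ?K n y z)"
      by (intro sum_mono)
    also have "\<dots> = (\<Sum>z\<in>F. ?K (n + n) z z)"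
      by (intro sum.cong refl) (simp add: kernel_power_add[OF F])
    finally have *: "(\<Sum>z\<in>F. \<Sum>y\<in>F. \<mu> z * (?K n z y)\<^sup>2) \<le> (\<Sum>z\<in>F. ?K (n + n) z z)" .
    \<comment> \<open>Cauchy--Schwarz over \<open>F\<close> is the source of the factor
      \<open>card F\<close>.\<close>
    have "A (n + n) \<le> (\<Sum>z\<in>F. \<mu> z * (card F * (\<Sum>y\<in>F. (?K n z y)\<^sup>2)))"
      unfolding A2 u_def
      by (intro sum_mono mult_left_mono \<mu>, subst mult.commute) (rule sum_squared_le_sum_of_squares)
    also have "\<dots> = card F * (\<Sum>z\<in>F. \<Sum>y\<in>F. \<mu> z * (?K n z y)\<^sup>2)"
      by (simp add: sum_distrib_left mult_ac)
    also have "\<dots> \<le> card F * (\<Sum>z\<in>F. ?K (n + n) z z)"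
      using * by (intro mult_left_mono) auto
    finally show ?thesis .
  qed
  show ?thesis using lower[of "Suc k"] trace[of "2 ^ k"] by (simp add: mult_2)
qed

section \<open>Powers of invariant, symmetric and open sets\<close>

lemma set_power_0 [simp]: "set_power V 0 = {0}"
  by (auto simp: set_power_def)

lemma set_power_Suc: "set_power V (Suc n) = {v + x | v x. v \<in> V \<and> x \<in> set_power V n}"
proof (intro equalityI subsetI)
  fix y assume "y \<in> set_power V (Suc n)"
  then obtain v us where "y = sum_list (v # us)" "length us = n" "set (v # us) \<subseteq> V"
    by (auto simp: set_power_def length_Suc_conv)
  then show "y \<in> {v + x | v x. v \<in> V \<and> x \<in> set_power V n}" by (auto simp: set_power_def)
next
  fix y assume "y \<in> {v + x | v x. v \<in> V \<and> x \<in> set_power V n}"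
  then obtain v us where "y = v + sum_list us" "v \<in> V" "length us = n" "set us \<subseteq> V"
    by (auto simp: set_power_def)
  then show "y \<in> set_power V (Suc n)" unfolding set_power_def by (intro CollectI exI[of _ "v # us"]) auto
qed

lemma set_power_mono: "V \<subseteq> U \<Longrightarrow> set_power V n \<subseteq> set_power U n"
  by (auto simp: set_power_def)

lemma set_power_conjugate:
  fixes V :: "'a::group_add set"
  assumes "\<And>g v. v \<in> V \<Longrightarrow> g + v - g \<in> V" and "x \<in> set_power V n"
  shows "g + x - g \<in> set_power V n"
  using assms(2)
proof (induction n arbitrary: x)
  case (Suc n)
  then obtain v y where x: "x = v + y" "v \<in> V" "y \<in> set_power V n" by (auto simp: set_power_Suc)
  have "g + x - g = (g + v - g) + (g + y - g)" by (simp add: x diff_conv_add_uminus add.assoc del: add_uminus_conv_diff)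
  then show ?case using assms(1) Suc.IH x unfolding set_power_Suc by blast
qed simp

text \<open>Inversion reverses the order of the factors; conjugation invariance brings the inverse
  of the first factor back to the front.\<close>

lemma set_power_uminus:
  fixes V :: "'a::group_add set"
  assumes conj: "\<And>g v. v \<in> V \<Longrightarrow> g + v - g \<in> V" and sym: "\<And>v. v \<in> V \<Longrightarrow> - v \<in> V" and "x \<in> set_power V n"
  shows "- x \<in> set_power V n"
  using assms(3)
proof (induction n arbitrary: x)
  case (Suc n)
  then obtain v y where x: "x = v + y" "v \<in> V" "y \<in> set_power V n" by (auto simp: set_power_Suc)
  have "- x = (- y + - v - - y) + - y" by (simp add: x minus_add)
  then show ?case using conj[OF sym] Suc.IH x unfolding set_power_Suc by blast
qed simp

text \<open>A union of translates of \<open>U\<close>. The exponent is a successor because the power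
  0 is \<open>{0}\<close>, which need not be open.\<close>

lemma open_set_power_Suc:
  fixes U :: "'a::topological_group_add set"
  assumes "open U"
  shows "open (set_power U (Suc n))"
proof -
  have "open {y. y - x \<in> U}" for x
  proof -
    have "continuous_on UNIV (\<lambda>y. y + - x)" by (intro continuous_on_add continuous_on_id continuous_on_const)
    from open_vimage[OF assms this] show ?thesis by (simp add: vimage_def)
  qed
  then have "open (\<Union>x\<in>set_power U n. {y. y - x \<in> U})" by blast
  also have "(\<Union>x\<in>set_power U n. {y. y - x \<in> U}) = set_power U (Suc n)"
    unfolding set_power_Suc by (force simp: intro: exI[of _ "_ - _"])
  finally show ?thesis .
qed

section \<open>Comparison of kernel powers with convolution powers\<close>

text \<open>In the convolution integral only the atoms of the first factor lying in \<open>E\<close>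
  are kept.\<close>

lemma conv_power_Suc_ge:
  fixes \<nu> :: "'a::{topological_group_add,t2_space} measure"
  assumes \<nu>: "sets \<nu> = sets borel" "countably_supported \<nu>" "prob_space \<nu>"
    and B: "B \<in> sets borel" and E: "finite E"
  shows "(\<Sum>g\<in>E. measure \<nu> {g} * measure (conv_power \<nu> n) {s. g + s \<in> B})
    \<le> measure (conv_power \<nu> (Suc n)) B"
proof -
  interpret \<nu>: prob_space \<nu> by fact
  interpret N: prob_space "conv_power \<nu> n" by (rule conv_power_properties[OF \<nu>])
  interpret N': prob_space "conv_power \<nu> (Suc n)" by (rule conv_power_properties[OF \<nu>])
  let ?f = "\<lambda>x. emeasure (conv_power \<nu> n) {s. x + s \<in> B}"
  have "ennreal (\<Sum>g\<in>E. measure \<nu> {g} * measure (conv_power \<nu> n) {s. g + s \<in> B})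
      = (\<Sum>g\<in>E. ?f g * emeasure \<nu> {g})"
    by (simp add: N.emeasure_eq_measure \<nu>.emeasure_eq_measure mult.commute flip: ennreal_mult sum_ennreal)
  also have "\<dots> = (\<Sum>g\<in>E. \<integral>\<^sup>+x. ?f g * indicator {g} x \<partial>\<nu>)"
    by (intro sum.cong refl nn_integral_cmult_indicator[symmetric]) (simp add: \<nu>)
  also have "\<dots> = (\<integral>\<^sup>+x. (\<Sum>g\<in>E. ?f g * indicator {g} x) \<partial>\<nu>)"
    by (intro nn_integral_sum[symmetric] borel_measurable_times_ennreal borel_measurable_const
        borel_measurable_indicator) (simp add: \<nu>)
  also have "\<dots> \<le> (\<integral>\<^sup>+x. ?f x \<partial>\<nu>)"
  proof (intro nn_integral_mono)
    fix x
    have "(\<Sum>g\<in>E. ?f g * indicator {g} x) = (\<Sum>g\<in>E. if g = x then ?f x else 0)"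
      by (intro sum.cong) (auto simp: indicator_def)
    also have "\<dots> \<le> ?f x" using E by simp
    finally show "(\<Sum>g\<in>E. ?f g * indicator {g} x) \<le> ?f x" .
  qed
  also have "\<dots> = emeasure (conv_power \<nu> (Suc n)) B"
    using emeasure_group_convolution[OF \<nu>(1) conv_power_properties(1,2)[OF \<nu>] B] by simp
  finally show ?thesis unfolding N'.emeasure_eq_measure by (simp only: ennreal_le_iff measure_nonneg)
qed

text \<open>Along a path from \<open>x\<close> to \<open>y\<close> whose labels have product
  \<open>s\<close>, the errors in \<open>V\<close> can all be moved to the left, so
  \<open>x = v + s + y\<close> with \<open>v\<close> in \<open>set_power V n\<close>. Hence
  \<open>B\<close> must contain every such \<open>s\<close>; it is arbitrary so that the induction
  can pass to \<open>{s. g + s \<in> B}\<close>.\<close>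

lemma kernel_power_le_conv_power:
  fixes \<nu> :: "'a::{topological_group_add,t2_space} measure" and V :: "'a set"
  assumes \<nu>: "sets \<nu> = sets borel" "countably_supported \<nu>" "prob_space \<nu>"
    and conj: "\<And>g v. v \<in> V \<Longrightarrow> g + v - g \<in> V"
    and E: "finite E" and F: "finite F"
    and \<kappa>: "\<And>g x y. 0 \<le> \<kappa> g x y" "\<And>g x y. \<kappa> g x y \<noteq> 0 \<Longrightarrow> x - (g + y) \<in> V"
      "\<And>g x. g \<in> E \<Longrightarrow> x \<in> F \<Longrightarrow> (\<Sum>y\<in>F. \<kappa> g x y) \<le> 1"
    and x: "x \<in> F" and B: "B \<in> sets borel" "\<And>v s. v \<in> set_power V n \<Longrightarrow> x = v + s + y \<Longrightarrow> s \<in> B"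
  shows "kernel_power F (\<lambda>x y. \<Sum>g\<in>E. measure \<nu> {g} * \<kappa> g x y) n x y \<le> measure (conv_power \<nu> n) B"
  using x B
proof (induction n arbitrary: x B)
  case 0
  \<comment> \<open>An empty path has \<open>x = y\<close>, and then the condition on
    \<open>B\<close> puts 0, the atom of \<open>conv_power \<nu> 0\<close>, into
    \<open>B\<close>.\<close>
  then show ?case using 0(3)[of 0 0] by (auto simp: measure_return)
next
  case (Suc n)
  let ?P = "\<lambda>x y. \<Sum>g\<in>E. measure \<nu> {g} * \<kappa> g x y"
  let ?m = "\<lambda>g. measure (conv_power \<nu> n) {s. g + s \<in> B}"
  have step: "\<kappa> g x z * kernel_power F ?P n z y \<le> \<kappa> g x z * ?m g" if z: "z \<in> F" for g z
  proof (cases "\<kappa> g x z = 0")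
    case False
    then have v1: "x - (g + z) \<in> V" by (rule \<kappa>)
    have "kernel_power F ?P n z y \<le> ?m g"
    proof (rule Suc.IH[OF z])
      show "{s. g + s \<in> B} \<in> sets borel" using Suc.prems by (intro translate_sets)
      fix v s assume v: "v \<in> set_power V n" and zv: "z = v + s + y"
      \<comment> \<open>Moving the error \<open>v\<close> to the left past the label
        \<open>g\<close> replaces it by a conjugate.\<close>
      have "(x - (g + z)) + (g + v - g) \<in> set_power V (Suc n)"
        using v1 set_power_conjugate[OF conj v] unfolding set_power_Suc by blast
      moreover have "x = (x - (g + z)) + (g + v - g) + (g + s) + y"
        unfolding zv by (simp add: diff_conv_add_uminus minus_add add.assoc del: add_uminus_conv_diff)
      ultimately show "s \<in> {s. g + s \<in> B}" using Suc.prems(3) by blast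
    qed
    then show ?thesis by (intro mult_left_mono \<kappa>)
  qed simp
  have "kernel_power F ?P (Suc n) x y
      = (\<Sum>z\<in>F. \<Sum>g\<in>E. measure \<nu> {g} * (\<kappa> g x z * kernel_power F ?P n z y))"
    by (simp add: sum_distrib_right mult.assoc)
  also have "\<dots> \<le> (\<Sum>z\<in>F. \<Sum>g\<in>E. measure \<nu> {g} * (\<kappa> g x z * ?m g))"
    by (intro sum_mono mult_left_mono step) auto
  also have "\<dots> = (\<Sum>g\<in>E. (\<Sum>z\<in>F. \<kappa> g x z) * (measure \<nu> {g} * ?m g))"
    by (subst sum.swap) (simp add: sum_distrib_right mult_ac)
  also have "\<dots> \<le> (\<Sum>g\<in>E. 1 * (measure \<nu> {g} * ?m g))"
    using Suc.prems by (intro sum_mono mult_right_mono \<kappa>) auto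
  also have "\<dots> \<le> measure (conv_power \<nu> (Suc n)) B"
    using conv_power_Suc_ge[OF \<nu> Suc.prems(2) E] by simp
  finally show ?case .
qed

subsection \<open>The lower bound\<close>

text \<open>The matching is averaged with its reversal \<open>\<pi> (- g) y x\<close>, which makes
  the later kernel reversible. Negating and conjugating \<open>y - (- g + x)\<close> yields
  \<open>x - (g + y)\<close>, so the reversal has the same admissible pairs.\<close>

lemma amenable_symmetric_matching:
  fixes E V :: "'a::topological_group_add set" and w :: "'a \<Rightarrow> real"
  assumes amen: "amenable_group TYPE('a)" and V: "V \<in> identity_nhds"
    and conj: "\<And>g v. v \<in> V \<Longrightarrow> g + v - g \<in> V" and sym: "\<And>v. v \<in> V \<Longrightarrow> - v \<in> V"
    and E: "finite E" "\<And>g. g \<in> E \<Longrightarrow> - g \<in> E"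
    and w: "\<And>g. 0 \<le> w g" "\<And>g. w g \<le> 1" "\<And>g. w (- g) = w g"
    and \<theta>: "\<theta> < sum w E"
  shows "\<exists>F \<mu> \<pi>. finite F \<and> fractional_matching F E (\<lambda>g x y. x - (g + y) \<in> V) \<mu> \<pi> \<and>
    (\<forall>g x y. \<pi> (- g) y x = \<pi> g x y) \<and> \<theta> \<le> (\<Sum>g\<in>E. \<Sum>x\<in>F. \<Sum>y\<in>F. w g * \<pi> g x y)"
proof -
  obtain F \<mu> \<pi> where F: "finite F" and match: "fractional_matching F E (\<lambda>g x y. x - (g + y) \<in> V) \<mu> \<pi>"
    and weight: "\<theta> \<le> (\<Sum>g\<in>E. \<Sum>x\<in>F. \<Sum>y\<in>F. w g * \<pi> g x y)"
    using amenable_matching[OF amen V E(1) w(1,2) \<theta>] by blast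
  note \<pi> = fractional_matchingD(3,4)[OF match] and row = fractional_matchingD(5)[OF match]
    and col = fractional_matchingD(6)[OF match]
  let ?\<pi> = "\<lambda>g x y. (\<pi> g x y + \<pi> (- g) y x) / 2"
  have "x - (g + y) \<in> V" if "?\<pi> g x y \<noteq> 0" for g x y
  proof -
    have "\<pi> g x y \<noteq> 0 \<or> \<pi> (- g) y x \<noteq> 0" using that by auto
    then show ?thesis
    proof
      assume "\<pi> (- g) y x \<noteq> 0"
      then have "g + - (y - (- g + x)) - g \<in> V" using \<pi> conj sym by blast
      also have "g + - (y - (- g + x)) - g = x - (g + y)"
        by (simp add: diff_conv_add_uminus minus_add add.assoc del: add_uminus_conv_diff)
      finally show ?thesis .
    qed (rule \<pi>)
  qed
  moreover have "(\<Sum>y\<in>F. ?\<pi> g x y) \<le> \<mu> x" "(\<Sum>y\<in>F. ?\<pi> g y x) \<le> \<mu> x" if "g \<in> E" "x \<in> F" for g x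
    using row[of g x] col[of "- g" x] row[of "- g" x] col[of g x] E(2)[of g] that
    by (simp_all add: sum.distrib flip: sum_divide_distrib)
  ultimately have "fractional_matching F E (\<lambda>g x y. x - (g + y) \<in> V) \<mu> ?\<pi>"
    using fractional_matchingD(1-3)[OF match] unfolding fractional_matching_def by simp
  moreover have "\<theta> \<le> (\<Sum>g\<in>E. \<Sum>x\<in>F. \<Sum>y\<in>F. w g * ?\<pi> g x y)"
  proof -
    have "(\<Sum>g\<in>E. \<Sum>x\<in>F. \<Sum>y\<in>F. w g * \<pi> (- g) y x) = (\<Sum>g\<in>E. \<Sum>x\<in>F. \<Sum>y\<in>F. w g * \<pi> g y x)"
      by (rule sum.reindex_bij_witness[of _ uminus uminus]) (auto simp: w E(2))
    also have "\<dots> = (\<Sum>g\<in>E. \<Sum>x\<in>F. \<Sum>y\<in>F. w g * \<pi> g x y)"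
      by (intro sum.cong refl sum.swap)
    finally show ?thesis
      using weight by (simp add: distrib_left sum.distrib add_divide_distrib flip: sum_divide_distrib)
  qed
  ultimately show ?thesis using F by (intro exI[of _ F] exI[of _ \<mu>] exI[of _ ?\<pi>]) (simp add: add.commute)
qed

lemma SIN_group_invariant_nhd:
  fixes U :: "'a::topological_group_add set"
  assumes "SIN_group TYPE('a)" and "U \<in> identity_nhds"
  obtains V where "V \<in> identity_nhds" "V \<subseteq> U" "\<And>g v. v \<in> V \<Longrightarrow> g + v - g \<in> V"
    "\<And>v. v \<in> V \<Longrightarrow> - v \<in> V"
proof -
  obtain W where W: "W \<in> identity_nhds" "W \<subseteq> U" and inv: "\<And>g. (\<lambda>x. g + x - g) ` W = W"
    using assms unfolding SIN_group_def by (metis subsetD)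
  have conj: "g + v - g \<in> W" if "v \<in> W" for g v using inv[of g] that by blast
  have "eventually (\<lambda>x. x \<in> W) (nhds 0)" using W by (simp add: identity_nhds_def)
  moreover from this have "eventually (\<lambda>x. - x \<in> W) (nhds 0)"
    using eventually_compose_filterlim[of "\<lambda>x. x \<in> W" "nhds 0" uminus "nhds 0"] tendsto_uminus_nhds[of "0::'a"]
    by simp
  ultimately have "{x. x \<in> W \<and> - x \<in> W} \<in> identity_nhds"
    by (simp add: identity_nhds_def eventually_conj)
  moreover have "- (g + v - g) \<in> W" if "- v \<in> W" for g v
    using conj[OF that, of g] by (simp add: diff_conv_add_uminus minus_add add.assoc del: add_uminus_conv_diff)
  ultimately show ?thesis using W conj by (intro that[of "{x. x \<in> W \<and> - x \<in> W}"]) auto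
qed

text \<open>Continuity from below along an enumeration of the support; adjoining negatives can only
  add mass.\<close>

lemma countably_supported_finite_symmetric:
  fixes \<nu> :: "'a::{topological_group_add,t2_space} measure"
  assumes \<nu>: "sets \<nu> = sets borel" "countably_supported \<nu>" "prob_space \<nu>" and "\<theta> < 1"
  obtains E where "finite E" "\<And>g. g \<in> E \<Longrightarrow> - g \<in> E" "\<theta> < (\<Sum>g\<in>E. measure \<nu> {g})"
proof -
  interpret prob_space \<nu> by fact
  have sing: "{x} \<in> sets \<nu>" for x using \<nu>(1) by simp
  have fin: "S \<in> sets \<nu>" if "countable S" for S by (rule sets.countable[OF sing that])
  obtain C where C: "countable C" "AE x in \<nu>. x \<in> C"
    using \<nu>(2) by (auto simp: countably_supported_def)
  then have "prob C = 1" using fin by (subst prob_eq_1) auto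
  then have "C \<noteq> {}" by auto
  define A where "A n = from_nat_into C ` {..n}" for n
  have "(\<lambda>n. prob (A n)) \<longlonglongrightarrow> prob (\<Union>n. A n)"
  proof (rule finite_Lim_measure_incseq)
    show "range A \<subseteq> sets \<nu>" unfolding A_def by (auto intro!: fin countable_finite)
    show "incseq A" unfolding A_def incseq_def by auto
  qed
  also have "(\<Union>n. A n) = from_nat_into C ` (\<Union>n. {..n})" by (simp add: A_def image_UN)
  also have "\<dots> = C"
    using range_from_nat_into[OF \<open>C \<noteq> {}\<close> C(1)] by (simp add: UN_atMost_UNIV)
  finally have "eventually (\<lambda>n. \<theta> < prob (A n)) sequentially"
    using \<open>prob C = 1\<close> \<open>\<theta> < 1\<close> by (auto dest: order_tendstoD(1))
  then obtain n where n: "\<theta> < prob (A n)" by (auto simp: eventually_sequentially)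
  define E where "E = A n \<union> uminus ` A n"
  have E: "finite E" by (simp add: E_def A_def)
  have "prob (A n) \<le> prob E"
    using E by (intro finite_measure_mono fin) (auto simp: E_def countable_finite)
  also have "prob E = (\<Sum>g\<in>E. prob {g})"
    using E sing by (intro finite_measure_eq_sum_singleton) auto
  finally show ?thesis using n E by (intro that[of E]) (auto simp: E_def)
qed

text \<open>\<open>N\<close> is the square of \<open>card F\<close>: one factor comes from the trace
  bound, one from the number of diagonal entries. It does not depend on \<open>k\<close>, so it
  vanishes under the roots.\<close>

lemma return_probability_lower_bound:
  fixes \<nu> :: "'a::{topological_group_add,t2_space} measure" and U :: "'a set"
  assumes amen: "amenable_group TYPE('a)" and SIN: "SIN_group TYPE('a)"
    and \<nu>: "sets \<nu> = sets borel" "countably_supported \<nu>" "prob_space \<nu>"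
    and sym: "symmetric_measure \<nu>"
    and U: "open U" "0 \<in> U" and \<theta>: "0 \<le> \<theta>" "\<theta> < 1"
  shows "\<exists>N>0. \<forall>k. \<theta> ^ 2 ^ Suc k
    \<le> N * measure (conv_power \<nu> (2 ^ Suc k)) (set_power U (2 ^ Suc k))"
proof -
  interpret prob_space \<nu> by fact
  have "U \<in> identity_nhds" using U by (auto simp: identity_nhds_def eventually_nhds)
  then obtain V where V: "V \<in> identity_nhds" "V \<subseteq> U" and conj: "\<And>g v. v \<in> V \<Longrightarrow> g + v - g \<in> V"
    and neg: "\<And>v. v \<in> V \<Longrightarrow> - v \<in> V"
    using SIN_group_invariant_nhd[OF SIN] by blast
  obtain E where E: "finite E" "\<And>g. g \<in> E \<Longrightarrow> - g \<in> E" "\<theta> < (\<Sum>g\<in>E. prob {g})"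
    using countably_supported_finite_symmetric[OF \<nu> \<theta>(2)] by blast
  have w_sym: "prob {- g} = prob {g}" for g
  proof -
    have "emeasure \<nu> {g} = emeasure \<nu> (uminus ` {g})"
      using sym unfolding symmetric_measure_def by (rule bspec) simp
    then show ?thesis by (simp add: measure_def)
  qed
  obtain F \<mu> \<pi> where F: "finite F" and match: "fractional_matching F E (\<lambda>g x y. x - (g + y) \<in> V) \<mu> \<pi>"
    and \<pi>_sym: "\<And>g x y. \<pi> (- g) y x = \<pi> g x y"
    and weight: "\<theta> \<le> (\<Sum>g\<in>E. \<Sum>x\<in>F. \<Sum>y\<in>F. prob {g} * \<pi> g x y)"
    using amenable_symmetric_matching[where w = "\<lambda>g. prob {g}",
        OF amen V(1) conj neg E(1,2) measure_nonneg prob_le_1 w_sym E(3)] by blast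
  note \<mu> = fractional_matchingD(1,2)[OF match] and \<pi> = fractional_matchingD(3,4)[OF match]
    and row = fractional_matchingD(5)[OF match]
  \<comment> \<open>Division by \<open>\<mu> x = 0\<close> is harmless: then \<open>\<pi> g x\<close> vanishes on \<open>F\<close>.\<close>
  define \<kappa> where "\<kappa> g x y = \<pi> g x y / \<mu> x" for g x y
  define P where "P x y = (\<Sum>g\<in>E. prob {g} * \<kappa> g x y)" for x y
  have \<pi>_zero: "\<pi> g x y = 0" if "\<mu> x = 0" "g \<in> E" "x \<in> F" "y \<in> F" for g x y
  proof -
    have "\<pi> g x y \<le> (\<Sum>y\<in>F. \<pi> g x y)" using F that by (intro member_le_sum \<pi>)
    also have "\<dots> \<le> 0" using row[of g x] that by simp
    finally show ?thesis using \<pi>(1)[of g x y] by simp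
  qed
  have \<mu>P: "\<mu> x * P x y = (\<Sum>g\<in>E. prob {g} * \<pi> g x y)" if "x \<in> F" "y \<in> F" for x y
    unfolding P_def \<kappa>_def sum_distrib_left
    using \<pi>_zero that by (intro sum.cong refl) (cases "\<mu> x = 0", auto)
  have rev: "\<mu> x * P x y = \<mu> y * P y x" if "x \<in> F" "y \<in> F" for x y
  proof -
    have "(\<Sum>g\<in>E. prob {g} * \<pi> g x y) = (\<Sum>g\<in>E. prob {g} * \<pi> g y x)"
      by (rule sum.reindex_bij_witness[of _ uminus uminus]) (auto simp: w_sym \<pi>_sym E(2))
    then show ?thesis using that by (simp add: \<mu>P)
  qed
  have "(\<Sum>g\<in>E. \<Sum>x\<in>F. \<Sum>y\<in>F. prob {g} * \<pi> g x y) = (\<Sum>x\<in>F. \<Sum>g\<in>E. \<Sum>y\<in>F. prob {g} * \<pi> g x y)"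
    by (rule sum.swap)
  also have "\<dots> = (\<Sum>x\<in>F. \<Sum>y\<in>F. \<mu> x * P x y)"
    by (rule sum.cong[OF refl], subst sum.swap) (simp add: \<mu>P)
  finally have weight': "\<theta> \<le> (\<Sum>x\<in>F. \<Sum>y\<in>F. \<mu> x * P x y)" using weight by simp
  have "F \<noteq> {}" using \<mu>(2) by auto
  have return: "kernel_power F P (Suc n) x x \<le> measure (conv_power \<nu> (Suc n)) (set_power U (Suc n))"
    if "x \<in> F" for x n
    unfolding P_def
  proof (rule kernel_power_le_conv_power[OF \<nu> conj E(1) F _ _ _ that])
    show "0 \<le> \<kappa> g x y" for g x y by (simp add: \<kappa>_def \<pi> \<mu>)
    show "x - (g + y) \<in> V" if "\<kappa> g x y \<noteq> 0" for g x y using that \<pi>(2) by (auto simp: \<kappa>_def)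
    show "(\<Sum>y\<in>F. \<kappa> g x y) \<le> 1" if "g \<in> E" "x \<in> F" for g x
      using row[OF that] \<mu>(1)[of x] by (cases "\<mu> x = 0") (simp_all add: \<kappa>_def flip: sum_divide_distrib)
    show "set_power U (Suc n) \<in> sets borel" using open_set_power_Suc[OF U(1)] by simp
    fix v s assume v: "v \<in> set_power V (Suc n)" and "x = v + s + x"
    \<comment> \<open>Cancelling the common endpoint leaves the label product as the inverse of an
      element of \<open>set_power V (Suc n)\<close>.\<close>
    then have "s = - v" by (metis add.left_neutral add_right_cancel minus_unique)
    then show "s \<in> set_power U (Suc n)"
      using set_power_uminus[OF conj neg v] set_power_mono[OF V(2)] by auto
  qed
  show ?thesis
  proof (intro exI[of _ "real (card F) * real (card F)"] conjI allI)
    show "0 < real (card F) * real (card F)" using F \<open>F \<noteq> {}\<close> by (simp add: card_gt_0_iff)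
    fix k
    obtain n where n: "(2::nat) ^ Suc k = Suc n" by (metis not0_implies_Suc power_not_zero zero_neq_numeral)
    have "\<theta> ^ 2 ^ Suc k \<le> card F * (\<Sum>x\<in>F. kernel_power F P (2 ^ Suc k) x x)"
      by (rule reversible_trace_bound[OF F \<mu> _ rev \<theta>(1) weight'])
        (auto simp: P_def \<kappa>_def \<pi> \<mu> intro!: sum_nonneg)
    also have "\<dots> \<le> card F * (\<Sum>x\<in>F. measure (conv_power \<nu> (2 ^ Suc k)) (set_power U (2 ^ Suc k)))"
      unfolding n by (intro mult_left_mono sum_mono return) auto
    finally show "\<theta> ^ 2 ^ Suc k
        \<le> real (card F) * real (card F) * measure (conv_power \<nu> (2 ^ Suc k)) (set_power U (2 ^ Suc k))"
      by (simp add: mult.assoc)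
  qed
qed

text \<open>The roots of the constant \<open>1 / N\<close> tend to 1, and a bound along a
  subsequence suffices for a limsup.\<close>

lemma limsup_root_ge:
  fixes m :: "nat \<Rightarrow> real" and r :: "nat \<Rightarrow> nat"
  assumes N: "0 < N" and \<theta>: "0 \<le> \<theta>" and r: "strict_mono r" and ge: "\<And>k. \<theta> ^ r k \<le> N * m (r k)"
  shows "ereal \<theta> \<le> limsup (\<lambda>n. ereal (root n (m n)))"
proof -
  have "(\<lambda>n. root n (1 / N) * \<theta>) \<longlonglongrightarrow> 1 * \<theta>"
    using N by (intro tendsto_mult LIMSEQ_root_const tendsto_const) simp
  then have "(\<lambda>k. root (r k) (1 / N) * \<theta>) \<longlonglongrightarrow> \<theta>"
    using LIMSEQ_subseq_LIMSEQ[OF _ r] by (fastforce simp: comp_def)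
  then have "ereal \<theta> = limsup (\<lambda>k. ereal (root (r k) (1 / N) * \<theta>))"
    by (intro lim_imp_Limsup[symmetric]) auto
  also have "\<dots> \<le> limsup ((\<lambda>n. ereal (root n (m n))) \<circ> r)"
  proof (rule Limsup_mono)
    have "root (r k) (1 / N) * \<theta> \<le> root (r k) (m (r k))" if "k > 0" for k
    proof -
      have rk: "r k > 0" using strict_mono_less[OF r, of 0 k] that by simp
      have "root (r k) (1 / N) * \<theta> = root (r k) (1 / N * \<theta> ^ r k)"
        using rk \<theta> by (simp only: real_root_mult real_root_power_cancel)
      also have "\<dots> \<le> root (r k) (m (r k))"
        using rk ge[of k] N by (intro real_root_le_mono) (simp_all add: field_simps)
      finally show ?thesis .
    qed
    then show "\<forall>\<^sub>F k in sequentially. ereal (root (r k) (1 / N) * \<theta>) \<le> ((\<lambda>n. ereal (root n (m n))) \<circ> r) k"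
      by (intro eventually_sequentiallyI[of 1]) auto
  qed
  also have "\<dots> \<le> limsup (\<lambda>n. ereal (root n (m n)))" by (rule limsup_subseq_mono[OF r])
  finally show ?thesis .
qed

theorem theoremB:
  fixes \<nu> :: "'a::{topological_group_add,t2_space} measure"
    and U :: "'a set"
  assumes "amenable_group TYPE('a)"
    and "SIN_group TYPE('a)"
    and "sets \<nu> = sets borel"
    and "prob_space \<nu>"
    and "regular_measure \<nu>"
    and "symmetric_measure \<nu>"
    and "countably_supported \<nu>"
    and "open U" and "0 \<in> U"
  shows "limsup (\<lambda>n. ereal (root n (measure (conv_power \<nu> n) (set_power U n)))) = 1"
proof (rule antisym)
  let ?m = "\<lambda>n. measure (conv_power \<nu> n) (set_power U n)"
  \<comment> \<open>At \<open>n = 0\<close> this holds by the convention that \<open>root 0\<close>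
    is 0.\<close>
  have "root n (?m n) \<le> 1" for n
  proof (cases "n = 0")
    case False
    have "?m n \<le> 1"
      using prob_space.prob_le_1[OF conv_power_properties(3)] assms(3,4,7) by blast
    then show ?thesis using False real_root_le_mono[of n "?m n" 1] by simp
  qed simp
  then show "limsup (\<lambda>n. ereal (root n (?m n))) \<le> 1"
    by (intro Limsup_bounded always_eventually) simp
  have ge: "ereal \<theta> \<le> limsup (\<lambda>n. ereal (root n (?m n)))" if \<theta>: "0 \<le> \<theta>" "\<theta> < 1" for \<theta>
  proof -
    obtain N where N: "0 < N" "\<And>k. \<theta> ^ 2 ^ Suc k \<le> N * ?m (2 ^ Suc k)"
      using return_probability_lower_bound[OF assms(1,2,3,7,4,6,8,9) \<theta>] by blast
    show ?thesis
      by (rule limsup_root_ge[where r = "\<lambda>k. 2 ^ Suc k", OF N(1) \<theta>(1) _ N(2)])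
        (simp add: strict_mono_Suc_iff)
  qed
  show "1 \<le> limsup (\<lambda>n. ereal (root n (?m n)))"
  proof (rule dense_le)
    fix x :: ereal assume "x < 1"
    then show "x \<le> limsup (\<lambda>n. ereal (root n (?m n)))"
    proof (cases x)
      case (real r)
      \<comment> \<open>The bound \<open>ge\<close> covers nonnegative \<open>\<theta>\<close> only,
        so negative \<open>r\<close> is raised to 0.\<close>
      have "x \<le> ereal (max 0 r)" by (simp add: real)
      also have "\<dots> \<le> limsup (\<lambda>n. ereal (root n (?m n)))"
        using \<open>x < 1\<close> by (intro ge) (auto simp: real)
      finally show ?thesis .
    qed auto
  qed
qed

end
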